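(* Let $(\xi_t)_{t\ge 0}$ be a doubly Feller process on $\mathbb{R}^d$, $(T_t)_{t\ge0}$ its Feller semigroup on $X=C_0(\mathbb{R}^d)$ and $(L,\mathrm{Dom}(L))$ its Feller generator. Let $(F(t))_{t\ge0}$ be a family of bounded linear operators on $X$ which is Chernoff equivalent to $(T_t)_{t\ge0}$, and let $D$ be a core for $(L,\mathrm{Dom}(L))$ such that $\lim_{t\to0}\left\|\frac{F(t)\varphi-\varphi}{t}-L\varphi\right\|_X=0$ for all $\varphi\in D$. Let $G\subset\mathbb{R}^d$ be a bounded regular domain, $(T^o_t)_{t\ge0}$ the Feller semigroup on $Y=C_0(G)$ of the process killed upon leaving $G$, and $(L_o,\mathrm{Dom}(L_o))$ its generator. Assume that there exist a set $D_o\subset \mathrm{Dom}(L_o)\cap C^2_b(G)$ and a mapping $\mathcal{E}:Y\to C_c(\mathbb{R}^d)\subset X$ such that (i) $D_o$ is a core for $L_o$; (ii) $\mathcal{E}(\varphi)|_{\overline G}=\varphi$ for all $\varphi\in Y$; (iii) $\mathcal{E}$ is linear; (iv) $\|\varphi\|_Y=\|\mathcal{E}(\varphi)\|_X$ for all $\varphi\in Y$; (v) $\mathcal{E}$ maps $D_o$ into $D$; (vi) $L(\mathcal{E}(\varphi))(x)=L_o\varphi(x)$ for each $\varphi\in D_o$ and each $x\in G$. Let $s:(0,\infty)\to(0,\infty)$ be a continuous monotone function with $\lim_{t\to0}s(t)/t=0$, put $G_{s(t)}:=\{x\in G:\ \mathrm{dist}(x,\partial G)>s(t)\}$, and let $(\phi_{s(t)})_{t>0}$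 be a family of functions $\phi_{s(t)}:\mathbb{R}^d\to[0,1]$ such that $\phi_{s(t)}\in C_c^\infty(G)$ and $\phi_{s(t)}(x)=1$ for all $x\in G_{s(t)}$, for every $t>0$, and $\lim_{t\to t^*}\|\phi_{s(t)}-\phi_{s(t^* )}\|_X=0$ for each $t^*>0$. Define $F_o(0):=\mathrm{Id}$ and, for $t>0$, $\varphi\in Y$, $x\in G$, $$F_o(t)\varphi(x):=\phi_{s(t)}(x)\,[F(t)\mathcal{E}(\varphi)](x).$$ Then the family $(F_o(t))_{t\ge0}$ is Chernoff equivalent to the semigroup $(T^o_t)_{t\ge0}$, i.e. $$T^o_t\varphi=\lim_{n\to\infty}[F_o(t/n)]^n\varphi$$ in $Y$ for each $\varphi\in Y$, locally uniformly with respect to $t\ge0$.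
   Context: Spaces. $X=C_0(\mathbb{R}^d)$ is the Banach space (supremum norm) of continuous functions on $\mathbb{R}^d$ vanishing at infinity. For a bounded domain (connected open set) $G\subset\mathbb{R}^d$, $Y=C_0(G)$ is the Banach space (supremum norm) of continuous functions on $G$ that tend to zero at $\partial G$; elements of $Y$ are regarded as equal to $0$ on $\partial G$. $C_c(\mathbb{R}^d)$: continuous functions with compact support. $C^2_b(G)$: functions in $C^2(G)$ whose partial derivatives up to order $2$ are bounded and continuous. Feller semigroups and processes. A Feller semigroup on $C_0(Q)$ ($Q$ a locally compact separable metric space) is a strongly continuous semigroup $(T_t)_{t\ge 0}$ of bounded linear operators which is positivity preserving and sub-Markovian ($\varphi\le 1\Rightarrow T_t\varphi\le1$); its Feller generator is its infinitesimal generator. A Feller process is a time-homogeneous Markov process $(\xi_t)_{t\ge0}$ whose transition semigroup $T_t\varphi(x)=\mathbb{E}^x[\varphi(\xi_t)]$ is a Feller semigroup (taken, as usual, with càdlàg paths). The semigroup (extended to bounded Borel functions $B_b(Q)$) is strong Feller if $T_t:B_b(Q)\to C_b(Q)$ for all $t>0$; process and semigroup are called doubly Feller if they are both Feller and strong Feller. Killed process. $\tau_G:=\inf\{t>0:\xi_t\notin G\}$. A point $x\in\partial G$ is regular for $G$ if $\mathbb{P}^x(\tau_G=0)=1$; $G$ is regular if every $x\in\partial G$ is regular. The killed process is $\xi^o_t=\xi_t$ for $t<\tau_G$ and $\xi^o_t=\partial$ (a cemetery point, where functions are set to $0$) for $t\ge\tau_G$. For a doubly Feller process and a bounded regular $G$,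 $T^o_t\varphi(x):=\mathbb{E}^x[\varphi(\xi^o_t)]$, $\varphi\in Y$, $x\in G$, defines a Feller semigroup on $Y$ (known fact), whose generator is denoted $(L_o,\mathrm{Dom}(L_o))$. Chernoff equivalence. A family $(F(t))_{t\ge0}$ of bounded linear operators on a Banach space $Z$ is Chernoff equivalent to a strongly continuous semigroup $(S_t)_{t\ge0}$ on $Z$ with generator $(A,\mathrm{Dom}(A))$ if: $F(0)=\mathrm{Id}$; $\|F(t)\|\le e^{wt}$ for some $w\in\mathbb{R}$ and all $t\ge0$; and there is a core $D$ for $(A,\mathrm{Dom}(A))$ (dense subspace such that the closure of $(A,D)$ is $(A,\mathrm{Dom}(A))$) with $\lim_{t\to0}\frac{F(t)\varphi-\varphi}{t}=A\varphi$ for all $\varphi\in D$. By the Chernoff theorem this implies $S_t\varphi=\lim_{n\to\infty}[F(t/n)]^n\varphi$ for all $\varphi\in Z$, locally uniformly in $t\ge0$. *)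

theory Defs
  imports "HOL-Probability.Probability"
begin

section \<open>Function spaces\<close>

text \<open>All Banach spaces below are closed subspaces \<open>Z\<close> of the ambient Banach space
  \<open>'a \<Rightarrow>\<^sub>C real\<close> of bounded continuous functions with the supremum norm. Operators on \<open>Z\<close> are
  total functions of which only the restriction to \<open>Z\<close> matters.\<close>

definition C0 :: "('a::euclidean_space \<Rightarrow>\<^sub>C real) set" where
  "C0 = {f. (apply_bcontfun f \<longlongrightarrow> 0) at_infinity}"

definition Cc :: "('a::euclidean_space \<Rightarrow>\<^sub>C real) set" where
  "Cc = {f. compact (closure {x. apply_bcontfun f x \<noteq> 0})}"

text \<open>For bounded open \<open>G\<close>, a continuous function on \<open>G\<close> that tends to zero at the boundary is
  represented by its extension by zero, which is continuous on the whole space and has the same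
  supremum norm; conversely every continuous function vanishing off \<open>G\<close> arises in this way.\<close>

definition C0_on :: "'a::euclidean_space set \<Rightarrow> ('a \<Rightarrow>\<^sub>C real) set" where
  "C0_on G = {f. \<forall>x. x \<notin> G \<longrightarrow> apply_bcontfun f x = 0}"

definition bcontfun_mult :: "('a::topological_space \<Rightarrow>\<^sub>C real) \<Rightarrow> ('a \<Rightarrow>\<^sub>C real) \<Rightarrow> ('a \<Rightarrow>\<^sub>C real)" where
  "bcontfun_mult f g = Bcontfun (\<lambda>x. apply_bcontfun f x * apply_bcontfun g x)"

lemma apply_bcontfun_mult [simp]:
  "apply_bcontfun (bcontfun_mult f g) x = apply_bcontfun f x * apply_bcontfun g x"
proof -
  have "(\<lambda>x. apply_bcontfun f x * apply_bcontfun g x) \<in> bcontfun"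
  proof (rule bcontfun_normI)
    show "continuous_on UNIV (\<lambda>x. apply_bcontfun f x * apply_bcontfun g x)"
      by (intro continuous_intros) auto
    show "norm (apply_bcontfun f x * apply_bcontfun g x) \<le> norm f * norm g" for x
      unfolding norm_mult by (intro mult_mono norm_bounded) auto
  qed
  then show ?thesis
    unfolding bcontfun_mult_def by (simp add: Bcontfun_inverse)
qed

text \<open>\<open>partials [i\<^sub>1, \<dots>, i\<^sub>k] f\<close> is the iterated partial derivative of \<open>f\<close> in the coordinate
  directions \<open>i\<^sub>1, \<dots>, i\<^sub>k\<close>.\<close>

primrec partials :: "'a::euclidean_space list \<Rightarrow> ('a \<Rightarrow> real) \<Rightarrow> 'a \<Rightarrow> real" where
  "partials [] f = f"
| "partials (i # is) f = (\<lambda>x. frechet_derivative (partials is f) (at x) i)"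

definition Ck_on :: "nat \<Rightarrow> 'a::euclidean_space set \<Rightarrow> ('a \<Rightarrow> real) \<Rightarrow> bool" where
  "Ck_on k G f \<longleftrightarrow>
     (\<forall>is\<in>lists Basis. length is < k \<longrightarrow> (\<forall>x\<in>G. partials is f differentiable at x)) \<and>
     (\<forall>is\<in>lists Basis. length is \<le> k \<longrightarrow> continuous_on G (partials is f))"

definition C2b_on :: "'a::euclidean_space set \<Rightarrow> ('a \<Rightarrow> real) \<Rightarrow> bool" where
  "C2b_on G f \<longleftrightarrow> Ck_on 2 G f \<and>
     (\<forall>is\<in>lists Basis. length is \<le> 2 \<longrightarrow> bounded (partials is f ` G))"

definition test_function_on :: "'a::euclidean_space set \<Rightarrow> ('a \<Rightarrow> real) \<Rightarrow> bool" where
  "test_function_on G f \<longleftrightarrow> (\<forall>k. Ck_on k UNIV f) \<and>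
     compact (closure {x. f x \<noteq> 0}) \<and> closure {x. f x \<noteq> 0} \<subseteq> G"


section \<open>Operator semigroups on a subspace\<close>

definition linear_map_on :: "'v::real_vector set \<Rightarrow> ('v \<Rightarrow> 'w::real_vector) \<Rightarrow> bool" where
  "linear_map_on Z A \<longleftrightarrow>
     (\<forall>u\<in>Z. \<forall>v\<in>Z. A (u + v) = A u + A v) \<and> (\<forall>c. \<forall>u\<in>Z. A (c *\<^sub>R u) = c *\<^sub>R A u)"

definition bounded_operator_on :: "'v::real_normed_vector set \<Rightarrow> ('v \<Rightarrow> 'v) \<Rightarrow> bool" where
  "bounded_operator_on Z A \<longleftrightarrow>
     (\<forall>u\<in>Z. A u \<in> Z) \<and> linear_map_on Z A \<and> (\<exists>K. \<forall>u\<in>Z. norm (A u) \<le> K * norm u)"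

text \<open>The operator norm of the restriction of \<open>A\<close> to \<open>Z\<close>, cf. \<open>onorm\<close> (the quotient is \<open>0\<close>
  for \<open>u = 0\<close>).\<close>

definition onorm_on :: "'v::real_normed_vector set \<Rightarrow> ('v \<Rightarrow> 'v) \<Rightarrow> real" where
  "onorm_on Z A = (SUP u\<in>Z. norm (A u) / norm u)"

definition sc_semigroup :: "'v::real_normed_vector set \<Rightarrow> (real \<Rightarrow> 'v \<Rightarrow> 'v) \<Rightarrow> bool" where
  "sc_semigroup Z S \<longleftrightarrow>
     (\<forall>t\<ge>0. bounded_operator_on Z (S t)) \<and>
     (\<forall>u\<in>Z. S 0 u = u) \<and>
     (\<forall>s\<ge>0. \<forall>t\<ge>0. \<forall>u\<in>Z. S (s + t) u = S s (S t u)) \<and>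
     (\<forall>u\<in>Z. continuous_on {0..} (\<lambda>t. S t u))"

definition gen_dom :: "'v::real_normed_vector set \<Rightarrow> (real \<Rightarrow> 'v \<Rightarrow> 'v) \<Rightarrow> 'v set" where
  "gen_dom Z S = {u \<in> Z. \<exists>v\<in>Z. ((\<lambda>t. (S t u - u) /\<^sub>R t) \<longlongrightarrow> v) (at_right 0)}"

definition gen :: "(real \<Rightarrow> 'v::real_normed_vector \<Rightarrow> 'v) \<Rightarrow> 'v \<Rightarrow> 'v" where
  "gen S u = Lim (at_right 0) (\<lambda>t. (S t u - u) /\<^sub>R t)"

text \<open>A core is a dense subspace of the domain such that the closure of the restricted generator
  is the generator; closures of operators are expressed through their graphs.\<close>

definition is_core :: "'v::real_normed_vector set \<Rightarrow> (real \<Rightarrow> 'v \<Rightarrow> 'v) \<Rightarrow> 'v set \<Rightarrow> bool" where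
  "is_core Z S D \<longleftrightarrow>
     subspace D \<and> D \<subseteq> gen_dom Z S \<and> Z \<subseteq> closure D \<and>
     closure ((\<lambda>u. (u, gen S u)) ` D) = (\<lambda>u. (u, gen S u)) ` gen_dom Z S"

definition chernoff_equivalent ::
    "'v::real_normed_vector set \<Rightarrow> (real \<Rightarrow> 'v \<Rightarrow> 'v) \<Rightarrow> (real \<Rightarrow> 'v \<Rightarrow> 'v) \<Rightarrow> bool" where
  "chernoff_equivalent Z F S \<longleftrightarrow>
     sc_semigroup Z S \<and>
     (\<forall>t\<ge>0. bounded_operator_on Z (F t)) \<and>
     (\<forall>u\<in>Z. F 0 u = u) \<and>
     (\<exists>w. \<forall>t\<ge>0. onorm_on Z (F t) \<le> exp (w * t)) \<and>
     (\<exists>D. is_core Z S D \<and>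
        (\<forall>u\<in>D. ((\<lambda>t. (F t u - u) /\<^sub>R t) \<longlongrightarrow> gen S u) (at_right 0)))"

definition feller_semigroup ::
    "('a::euclidean_space \<Rightarrow>\<^sub>C real) set \<Rightarrow> (real \<Rightarrow> ('a \<Rightarrow>\<^sub>C real) \<Rightarrow> ('a \<Rightarrow>\<^sub>C real)) \<Rightarrow> bool" where
  "feller_semigroup Z T \<longleftrightarrow>
     sc_semigroup Z T \<and>
     (\<forall>t\<ge>0. \<forall>f\<in>Z. (\<forall>x. 0 \<le> apply_bcontfun f x) \<longrightarrow> (\<forall>x. 0 \<le> apply_bcontfun (T t f) x)) \<and>
     (\<forall>t\<ge>0. \<forall>f\<in>Z. (\<forall>x. apply_bcontfun f x \<le> 1) \<longrightarrow> (\<forall>x. apply_bcontfun (T t f) x \<le> 1))"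


section \<open>Feller processes\<close>

text \<open>A process takes values in \<open>'a option\<close>, where \<open>None\<close> is the cemetery point; functions on
  the state space are extended by \<open>0\<close> to the cemetery. A process with infinite lifetime is one
  that never takes the value \<open>None\<close>.\<close>

definition zero_ext :: "('a \<Rightarrow> real) \<Rightarrow> 'a option \<Rightarrow> real" where
  "zero_ext f z = (case z of None \<Rightarrow> 0 | Some x \<Rightarrow> f x)"

definition transition_op ::
    "('a \<Rightarrow> 'w measure) \<Rightarrow> (real \<Rightarrow> 'w \<Rightarrow> 'a option) \<Rightarrow> real \<Rightarrow> ('a \<Rightarrow> real) \<Rightarrow> 'a \<Rightarrow> real" where
  "transition_op P \<xi> t f x = (\<integral>\<omega>. zero_ext f (\<xi> t \<omega>) \<partial>P x)"

definition natural_filtration ::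
    "'w measure \<Rightarrow> (real \<Rightarrow> 'w \<Rightarrow> 'a::euclidean_space option) \<Rightarrow> real \<Rightarrow> 'w measure" where
  "natural_filtration M \<xi> t =
     sigma (space M) {\<xi> s -` (Some ` B) \<inter> space M | s B. 0 \<le> s \<and> s \<le> t \<and> B \<in> sets borel}"

text \<open>The Markov property at time \<open>t\<close> with \<open>f = 1\<close> shows that the cemetery is almost surely
  absorbing.\<close>

definition markov_process ::
    "'w measure \<Rightarrow> ('a::euclidean_space \<Rightarrow> 'w measure) \<Rightarrow> (real \<Rightarrow> 'w \<Rightarrow> 'a option) \<Rightarrow> bool" where
  "markov_process M P \<xi> \<longleftrightarrow>
     (\<forall>x. prob_space (P x) \<and> space (P x) = space M \<and> sets (P x) = sets M) \<and>
     (\<forall>t\<ge>0. \<forall>B\<in>sets borel. \<xi> t -` (Some ` B) \<inter> space M \<in> sets M) \<and>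
     (\<forall>t\<ge>0. \<forall>B\<in>sets borel.
        (\<lambda>x. measure (P x) (\<xi> t -` (Some ` B) \<inter> space M)) \<in> borel_measurable borel) \<and>
     (\<forall>x. measure (P x) {\<omega> \<in> space M. \<xi> 0 \<omega> = Some x} = 1) \<and>
     (\<forall>s\<ge>0. \<forall>t\<ge>0. \<forall>x. \<forall>f\<in>borel_measurable borel. bounded (range f) \<longrightarrow>
        (AE \<omega> in P x.
           real_cond_exp (P x) (natural_filtration M \<xi> t) (\<lambda>\<omega>. zero_ext f (\<xi> (t + s) \<omega>)) \<omega>
             = zero_ext (transition_op P \<xi> s f) (\<xi> t \<omega>)))"

text \<open>Right-continuity and left limits are taken in the one-point compactification of the state
  space, the cemetery being the point at infinity.\<close>

definition cadlag_paths :: "'w measure \<Rightarrow> (real \<Rightarrow> 'w \<Rightarrow> 'a::euclidean_space option) \<Rightarrow> bool" where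
  "cadlag_paths M \<xi> \<longleftrightarrow> (\<forall>\<omega>\<in>space M.
     (\<forall>t\<ge>0. limitin (Alexandroff_compactification euclidean) (\<lambda>s. \<xi> s \<omega>) (\<xi> t \<omega>) (at_right t)) \<and>
     (\<forall>t>0. \<exists>l. limitin (Alexandroff_compactification euclidean) (\<lambda>s. \<xi> s \<omega>) l (at_left t)))"

definition feller_process ::
    "'w measure \<Rightarrow> ('a::euclidean_space \<Rightarrow> 'w measure) \<Rightarrow> (real \<Rightarrow> 'w \<Rightarrow> 'a option) \<Rightarrow>
     (real \<Rightarrow> ('a \<Rightarrow>\<^sub>C real) \<Rightarrow> ('a \<Rightarrow>\<^sub>C real)) \<Rightarrow> bool" where
  "feller_process M P \<xi> T \<longleftrightarrow>
     markov_process M P \<xi> \<and> cadlag_paths M \<xi> \<and> feller_semigroup C0 T \<and>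
     (\<forall>t\<ge>0. \<forall>f\<in>C0. \<forall>x. apply_bcontfun (T t f) x = transition_op P \<xi> t (apply_bcontfun f) x)"

definition strong_feller ::
    "('a::euclidean_space \<Rightarrow> 'w measure) \<Rightarrow> (real \<Rightarrow> 'w \<Rightarrow> 'a option) \<Rightarrow> bool" where
  "strong_feller P \<xi> \<longleftrightarrow>
     (\<forall>t>0. \<forall>f\<in>borel_measurable borel. bounded (range f) \<longrightarrow> transition_op P \<xi> t f \<in> bcontfun)"

definition doubly_feller_process ::
    "'w measure \<Rightarrow> ('a::euclidean_space \<Rightarrow> 'w measure) \<Rightarrow> (real \<Rightarrow> 'w \<Rightarrow> 'a option) \<Rightarrow>
     (real \<Rightarrow> ('a \<Rightarrow>\<^sub>C real) \<Rightarrow> ('a \<Rightarrow>\<^sub>C real)) \<Rightarrow> bool" where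
  "doubly_feller_process M P \<xi> T \<longleftrightarrow> feller_process M P \<xi> T \<and> strong_feller P \<xi>"


section \<open>The killed process\<close>

definition exit_time :: "(real \<Rightarrow> 'w \<Rightarrow> 'a option) \<Rightarrow> 'a set \<Rightarrow> 'w \<Rightarrow> ereal" where
  "exit_time \<xi> G \<omega> = Inf (ereal ` {t. 0 < t \<and> \<xi> t \<omega> \<notin> Some ` G})"

definition killed_process ::
    "(real \<Rightarrow> 'w \<Rightarrow> 'a option) \<Rightarrow> 'a set \<Rightarrow> real \<Rightarrow> 'w \<Rightarrow> 'a option" where
  "killed_process \<xi> G t \<omega> = (if ereal t < exit_time \<xi> G \<omega> then \<xi> t \<omega> else None)"

text \<open>For a process with cadlag paths the exit time is in general only measurable with respect
  to the completed \<open>\<sigma>\<close>-algebra (the time of hitting the closed complement of \<open>G\<close> is a debut), so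
  probabilities and expectations involving it are taken under the completed measures.\<close>

definition regular_set ::
    "('a::euclidean_space \<Rightarrow> 'w measure) \<Rightarrow> (real \<Rightarrow> 'w \<Rightarrow> 'a option) \<Rightarrow> 'a set \<Rightarrow> bool" where
  "regular_set P \<xi> G \<longleftrightarrow>
     (\<forall>x\<in>frontier G. measure (completion (P x)) {\<omega> \<in> space (P x). exit_time \<xi> G \<omega> = 0} = 1)"

definition killed_feller_semigroup ::
    "('a::euclidean_space \<Rightarrow> 'w measure) \<Rightarrow> (real \<Rightarrow> 'w \<Rightarrow> 'a option) \<Rightarrow> 'a set \<Rightarrow>
     (real \<Rightarrow> ('a \<Rightarrow>\<^sub>C real) \<Rightarrow> ('a \<Rightarrow>\<^sub>C real)) \<Rightarrow> bool" where
  "killed_feller_semigroup P \<xi> G To \<longleftrightarrow>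
     feller_semigroup (C0_on G) To \<and>
     (\<forall>t\<ge>0. \<forall>f\<in>C0_on G. \<forall>x\<in>G. apply_bcontfun (To t f) x =
        transition_op (\<lambda>y. completion (P y)) (killed_process \<xi> G) t (apply_bcontfun f) x)"


section \<open>The approximating family\<close>

text \<open>Each \<open>\<phi> t\<close> vanishes off \<open>G\<close>, so the product below is the extension by zero of the function
  \<open>\<phi> t \<cdot> F t (E f)\<close> on \<open>G\<close>.\<close>

definition killed_family ::
    "(real \<Rightarrow> 'a::euclidean_space \<Rightarrow>\<^sub>C real) \<Rightarrow> (real \<Rightarrow> ('a \<Rightarrow>\<^sub>C real) \<Rightarrow> ('a \<Rightarrow>\<^sub>C real)) \<Rightarrow>
     (('a \<Rightarrow>\<^sub>C real) \<Rightarrow> ('a \<Rightarrow>\<^sub>C real)) \<Rightarrow> real \<Rightarrow> ('a \<Rightarrow>\<^sub>C real) \<Rightarrow> ('a \<Rightarrow>\<^sub>C real)" where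
  "killed_family \<phi> F E t f = (if t = 0 then f else bcontfun_mult (\<phi> t) (F t (E f)))"

end

theory Submission
  imports Defs
begin

text \<open>
  On the core, \<open>(F\<^sub>o(t)f - f)/t - L\<^sub>o f\<close> splits on \<open>G\<close> into \<open>\<phi> [(F(t)Ef - Ef)/t - L(Ef)]\<close>,
  \<open>(\<phi> - 1) L\<^sub>o f\<close> and \<open>(\<phi> - 1) f / t\<close>. The last two live within distance \<open>s(t)\<close> of the
  boundary. There \<open>L\<^sub>o f\<close> is small because it vanishes at the boundary, and \<open>\<bar>f\<bar>\<close> is at most
  \<open>C s(t)\<close> because \<open>f\<close> has bounded derivative, so \<open>s(t)/t \<rightarrow> 0\<close> suffices.

  Chernoff's theorem for a contraction semigroup \<open>S\<close> is proved without resolvents. For \<open>u\<close> in the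
  domain of the generator, choose elements \<open>d\<^sub>i\<close> of the core close to \<open>S(ih)u\<close> in the graph norm and
  let \<open>z\<close> be their piecewise linear interpolation. Then \<open>z\<close> solves the Cauchy problem
  approximately and takes values in the spans of finitely many core elements, on which
  \<open>(F(s) - 1)/s\<close> converges uniformly to the generator; so \<open>F(s)z(r) - z(r+s)\<close> is uniformly small
  compared with \<open>s\<close> and the errors telescope by stability.
\<close>

section \<open>Contraction semigroups\<close>

text \<open>Feller semigroups are of this kind by \<open>feller_contraction\<close>. Contractivity
  lets \<open>S p\<close> carry an estimate at time 0 over to time \<open>p\<close> without
  loss.\<close>

locale contraction_semigroup =
  fixes Z :: "'v::real_normed_vector set" and S :: "real \<Rightarrow> 'v \<Rightarrow> 'v"
  assumes subspace: "subspace Z"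
    and semigroup: "sc_semigroup Z S"
    and norm_S_le: "0 \<le> t \<Longrightarrow> u \<in> Z \<Longrightarrow> norm (S t u) \<le> norm u"
begin

lemma
  assumes "0 \<le> t"
  shows S_closed: "u \<in> Z \<Longrightarrow> S t u \<in> Z"
    and S_add: "u \<in> Z \<Longrightarrow> v \<in> Z \<Longrightarrow> S t (u + v) = S t u + S t v"
    and S_scale: "u \<in> Z \<Longrightarrow> S t (c *\<^sub>R u) = c *\<^sub>R S t u"
  using semigroup assms unfolding sc_semigroup_def bounded_operator_on_def linear_map_on_def
  by blast+

lemma S_diff:
  assumes "0 \<le> t" "u \<in> Z" "v \<in> Z"
  shows "S t (u - v) = S t u - S t v"
  using S_add[of t u "- 1 *\<^sub>R v"] S_scale[of t v "- 1"] assms subspace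
  by (simp add: subspace_neg)

lemma S_zero: "u \<in> Z \<Longrightarrow> S 0 u = u"
  and S_semigroup: "0 \<le> s \<Longrightarrow> 0 \<le> t \<Longrightarrow> u \<in> Z \<Longrightarrow> S (s + t) u = S s (S t u)"
  and S_continuous: "u \<in> Z \<Longrightarrow> continuous_on {0..} (\<lambda>t. S t u)"
  using semigroup unfolding sc_semigroup_def by blast+

lemma norm_S_diff_le:
  assumes "0 \<le> t" "u \<in> Z" "v \<in> Z"
  shows "norm (S t u - S t v) \<le> norm (u - v)"
  using norm_S_le[of t "u - v"] S_diff assms subspace by (simp add: subspace_diff)

lemma near_zero:
  assumes "u \<in> Z" "0 < \<epsilon>"
  obtains h where "0 < h" "\<And>r. 0 \<le> r \<Longrightarrow> r \<le> h \<Longrightarrow> norm (S r u - u) \<le> \<epsilon>"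
proof -
  obtain d where d: "0 < d" "\<And>r. r \<in> {0..} \<Longrightarrow> dist r 0 < d \<Longrightarrow> dist (S r u) (S 0 u) < \<epsilon>"
    using S_continuous[OF assms(1)] assms(2) unfolding continuous_on_iff by (metis atLeast_iff order_refl)
  show ?thesis
  proof
    show "0 < d/2" using d by simp
    show "norm (S r u - u) \<le> \<epsilon>" if "0 \<le> r" "r \<le> d/2" for r
      using d(2)[of r] d(1) that S_zero[OF assms(1)] by (simp add: dist_norm)
  qed
qed

text \<open>The increment is \<open>S p\<close> applied to \<open>S (q - p) u - u\<close>, so a
  modulus of continuity at time 0 serves along the whole orbit.\<close>

lemma increment_le:
  assumes "u \<in> Z" "\<And>r. 0 \<le> r \<Longrightarrow> r \<le> h \<Longrightarrow> norm (S r u - u) \<le> \<epsilon>" "0 \<le> p" "p \<le> q" "q \<le> p + h"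
  shows "norm (S q u - S p u) \<le> \<epsilon>"
proof -
  have "S q u = S p (S (q - p) u)" using S_semigroup[of p "q - p" u] assms by simp
  then have "norm (S q u - S p u) \<le> norm (S (q - p) u - u)"
    using norm_S_diff_le[of p "S (q - p) u" u] S_closed[of "q - p" u] assms by simp
  also have "\<dots> \<le> \<epsilon>" using assms by simp
  finally show ?thesis .
qed

section \<open>The generator: commutation with the semigroup and first-order expansion\<close>

lemma gen_dom_Z: "u \<in> gen_dom Z S \<Longrightarrow> u \<in> Z"
  unfolding gen_dom_def by blast

lemma genI:
  assumes "u \<in> Z" "v \<in> Z" "((\<lambda>t. (S t u - u) /\<^sub>R t) \<longlongrightarrow> v) (at_right 0)"
  shows "u \<in> gen_dom Z S" "gen S u = v"
proof -
  show "u \<in> gen_dom Z S" using assms unfolding gen_dom_def by blast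
  show "gen S u = v" unfolding gen_def by (rule tendsto_Lim[OF _ assms(3)]) simp
qed

lemma
  assumes "u \<in> gen_dom Z S"
  shows gen_tendsto: "((\<lambda>t. (S t u - u) /\<^sub>R t) \<longlongrightarrow> gen S u) (at_right 0)"
    and gen_Z: "gen S u \<in> Z"
proof -
  obtain v where v: "v \<in> Z" "((\<lambda>t. (S t u - u) /\<^sub>R t) \<longlongrightarrow> v) (at_right 0)"
    using assms unfolding gen_dom_def by blast
  then have "gen S u = v" using genI(2)[OF gen_dom_Z[OF assms]] by blast
  with v show "((\<lambda>t. (S t u - u) /\<^sub>R t) \<longlongrightarrow> gen S u) (at_right 0)" "gen S u \<in> Z"
    by simp_all
qed

text \<open>The difference quotient of \<open>S t u\<close> is \<open>S t\<close> applied to that of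
  \<open>u\<close>, and \<open>S t\<close> is linear and contractive, so convergence is
  inherited.\<close>

lemma gen_commute:
  assumes u: "u \<in> gen_dom Z S" and t: "0 \<le> t"
  shows "S t u \<in> gen_dom Z S" "gen S (S t u) = S t (gen S u)"
proof -
  have uZ: "u \<in> Z" and gZ: "gen S u \<in> Z" using u gen_dom_Z gen_Z by blast+
  have "norm ((S r (S t u) - S t u) /\<^sub>R r - S t (gen S u)) \<le> norm ((S r u - u) /\<^sub>R r - gen S u)"
    if "r > 0" for r
  proof -
    have "(S r (S t u) - S t u) /\<^sub>R r = S t ((S r u - u) /\<^sub>R r)"
      using that t uZ S_closed[of r u] subspace S_semigroup[of r t u] S_semigroup[of t r u]
      by (simp add: S_scale S_diff subspace_diff add.commute)
    then show ?thesis
      using that t uZ gZ S_closed[of r u] subspace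
        norm_S_diff_le[of t "(S r u - u) /\<^sub>R r" "gen S u"]
      by (simp add: subspace_diff subspace_scale)
  qed
  then have "\<forall>\<^sub>F r in at_right 0. norm ((S r (S t u) - S t u) /\<^sub>R r - S t (gen S u))
      \<le> norm ((S r u - u) /\<^sub>R r - gen S u)"
    by (rule eventually_mono[OF eventually_at_right_less])
  then have "((\<lambda>r. (S r (S t u) - S t u) /\<^sub>R r - S t (gen S u)) \<longlongrightarrow> 0) (at_right 0)"
    by (rule Lim_null_comparison)
       (intro tendsto_norm_zero LIM_zero gen_tendsto u)
  then have "((\<lambda>r. (S r (S t u) - S t u) /\<^sub>R r) \<longlongrightarrow> S t (gen S u)) (at_right 0)"
    by (rule LIM_zero_cancel)
  then show "S t u \<in> gen_dom Z S" "gen S (S t u) = S t (gen S u)"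
    by (rule genI[OF S_closed[OF t uZ] S_closed[OF t gZ]])+
qed

text \<open>This stands in for the integral formula for \<open>S h u - u\<close>. The interval is
  cut into \<open>N\<close> short steps. A step starting at time \<open>p\<close> contributes the
  error of the difference quotient at 0, carried along by \<open>S p\<close>, and the drift of
  \<open>S p v\<close> away from \<open>v\<close>.\<close>

lemma taylor_le:
  assumes u: "u \<in> gen_dom Z S" and h: "0 \<le> h"
    and mod: "\<And>r. 0 \<le> r \<Longrightarrow> r \<le> h \<Longrightarrow> norm (S r (gen S u) - gen S u) \<le> \<epsilon>"
  shows "norm (S h u - u - h *\<^sub>R gen S u) \<le> h * \<epsilon>"
proof (cases "h = 0")
  case True
  then show ?thesis using S_zero gen_dom_Z u by simp
next
  case False
  then have h0: "0 < h" using h by simp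
  define v where "v = gen S u"
  have uZ: "u \<in> Z" and vZ: "v \<in> Z" using u gen_dom_Z gen_Z v_def by blast+
  \<comment> \<open>\<open>\<delta>\<close> is the allowed error of the difference quotient at time
    0; it is sent to 0 at the end.\<close>
  have "norm (S h u - u - h *\<^sub>R v) \<le> h * \<epsilon> + h * \<delta>" if "0 < \<delta>" for \<delta>
  proof -
    have "\<forall>\<^sub>F t in at_right 0. dist ((S t u - u) /\<^sub>R t) v < \<delta>"
      using gen_tendsto[OF u] that unfolding v_def by (rule tendstoD)
    then obtain e where e: "e > 0" "\<And>t. 0 < t \<Longrightarrow> t < e \<Longrightarrow> dist ((S t u - u) /\<^sub>R t) v < \<delta>"
      unfolding eventually_at_right_field by auto
    \<comment> \<open>\<open>N\<close> is chosen so that the step length \<open>h / N\<close> falls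
      below \<open>e\<close>, where the quotient is within \<open>\<delta>\<close> of its
      limit.\<close>
    obtain N :: nat where N: "h / e < real N" using reals_Archimedean2 by blast
    define \<tau> where "\<tau> = h / real N"
    have N0: "0 < real N" using N h0 e(1) by (meson divide_pos_pos less_trans)
    have \<tau>: "0 < \<tau>" "\<tau> < e" "real N * \<tau> = h"
      using N N0 h0 e(1) by (auto simp: \<tau>_def field_simps)
    have one: "norm (S \<tau> u - u - \<tau> *\<^sub>R v) \<le> \<tau> * \<delta>"
    proof -
      have "S \<tau> u - u - \<tau> *\<^sub>R v = \<tau> *\<^sub>R ((S \<tau> u - u) /\<^sub>R \<tau> - v)"
        using \<tau> by (simp add: scaleR_diff_right)
      then show ?thesis using e(2)[OF \<tau>(1,2)] \<tau>(1) by (simp add: dist_norm)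
    qed
    have "norm (S (real k * \<tau>) u - u - (real k * \<tau>) *\<^sub>R v) \<le> real k * \<tau> * (\<epsilon> + \<delta>)" if "k \<le> N" for k
      using that
    proof (induction k)
      case 0
      then show ?case using S_zero uZ by simp
    next
      case (Suc k)
      define p where "p = real k * \<tau>"
      have p: "0 \<le> p" "real (Suc k) * \<tau> = p + \<tau>" using \<tau>(1) by (simp_all add: p_def algebra_simps)
      have ph: "p \<le> h" using Suc.prems \<tau>(1) unfolding p_def \<tau>(3)[symmetric] by simp
      have w: "S \<tau> u - u - \<tau> *\<^sub>R v \<in> Z" "S \<tau> u - u \<in> Z" "\<tau> *\<^sub>R v \<in> Z" "S \<tau> u \<in> Z"
        using uZ vZ S_closed \<tau>(1) subspace by (auto simp: subspace_diff subspace_scale)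
      have "S p (S \<tau> u - u - \<tau> *\<^sub>R v) = S (p + \<tau>) u - S p u - \<tau> *\<^sub>R S p v"
        using w p uZ vZ \<tau>(1) by (simp add: S_diff S_scale S_semigroup)
      then have "S (p + \<tau>) u - u - (p + \<tau>) *\<^sub>R v
          = (S p u - u - p *\<^sub>R v) + (S p (S \<tau> u - u - \<tau> *\<^sub>R v) + \<tau> *\<^sub>R (S p v - v))"
        by (simp add: algebra_simps)
      then have "norm (S (p + \<tau>) u - u - (p + \<tau>) *\<^sub>R v) \<le>
          norm (S p u - u - p *\<^sub>R v) + (norm (S p (S \<tau> u - u - \<tau> *\<^sub>R v)) + norm (\<tau> *\<^sub>R (S p v - v)))"
        by (metis norm_triangle_ineq norm_triangle_mono order_refl)
      also have "\<dots> \<le> p * (\<epsilon> + \<delta>) + (\<tau> * \<delta> + \<tau> * \<epsilon>)"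
      proof (intro add_mono)
        show "norm (S p u - u - p *\<^sub>R v) \<le> p * (\<epsilon> + \<delta>)" using Suc p_def by simp
        show "norm (S p (S \<tau> u - u - \<tau> *\<^sub>R v)) \<le> \<tau> * \<delta>"
          using norm_S_le[OF p(1) w(1)] one by simp
        show "norm (\<tau> *\<^sub>R (S p v - v)) \<le> \<tau> * \<epsilon>"
          using mod[OF p(1) ph] \<tau>(1) by (simp add: v_def)
      qed
      finally show ?case unfolding p(2) by (simp add: algebra_simps)
    qed
    from this[of N] show ?thesis unfolding \<tau>(3) by (simp add: algebra_simps)
  qed
  note le = this
  have "norm (S h u - u - h *\<^sub>R v) \<le> h * \<epsilon> + e" if "e > 0" for e
    using le[of "e / h"] h0 that by simp
  then show ?thesis unfolding v_def by (rule field_le_epsilon)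
qed

end

section \<open>Chernoff's theorem\<close>

lemma onorm_on_bound:
  assumes "bounded_operator_on Z A" "onorm_on Z A \<le> c" "u \<in> Z"
  shows "norm (A u) \<le> c * norm u"
proof (cases "u = 0")
  case True
  then show ?thesis using assms unfolding bounded_operator_on_def by (metis mult_zero_right norm_zero)
next
  case False
  obtain K where K: "\<And>u. u \<in> Z \<Longrightarrow> norm (A u) \<le> K * norm u"
    using assms(1) unfolding bounded_operator_on_def by blast
  have "norm (A u) / norm u \<le> \<bar>K\<bar>" if "u \<in> Z" for u
    using K[OF that] abs_ge_self[of K] 
    by (cases "u = 0") (auto simp: pos_divide_le_eq intro: order_trans[OF _ mult_right_mono])
  \<comment> \<open>A supremum of reals dominates its set only if the set is bounded above, which
    boundedness of \<open>A\<close> supplies.\<close>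
  then have "norm (A u) / norm u \<le> onorm_on Z A"
    unfolding onorm_on_def using assms(3) by (intro cSUP_upper bdd_aboveI2[where M="\<bar>K\<bar>"]) auto
  then have "norm (A u) / norm u \<le> c" using assms(2) by linarith
  then show ?thesis using False by (simp add: divide_le_eq)
qed

lemma linear_map_on_diff:
  assumes "linear_map_on Z A" "subspace Z" "u \<in> Z" "v \<in> Z"
  shows "A (u - v) = A u - A v"
proof -
  have "A (u + - 1 *\<^sub>R v) = A u + - 1 *\<^sub>R A v"
    using assms unfolding linear_map_on_def by (metis subspace_scale)
  then show ?thesis by simp
qed

lemma funpow_bound:
  fixes A :: "'v::real_normed_vector \<Rightarrow> 'v"
  assumes "\<And>u. u \<in> Z \<Longrightarrow> A u \<in> Z" "\<And>u. u \<in> Z \<Longrightarrow> norm (A u) \<le> c * norm u" "0 \<le> c" "u \<in> Z"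
  shows "(A ^^ n) u \<in> Z \<and> norm ((A ^^ n) u) \<le> c ^ n * norm u"
proof (induction n)
  case 0
  then show ?case using assms by simp
next
  case (Suc n)
  have "norm (A ((A ^^ n) u)) \<le> c * norm ((A ^^ n) u)" using Suc assms by blast
  also have "\<dots> \<le> c * (c ^ n * norm u)" using Suc assms(3) by (intro mult_left_mono) auto
  finally show ?case using Suc assms(1) by simp
qed

lemma linear_map_on_funpow:
  assumes "linear_map_on Z A" "\<And>u. u \<in> Z \<Longrightarrow> A u \<in> Z" "subspace Z"
  shows "linear_map_on Z (A ^^ n)"
proof -
  have "(A ^^ n) u \<in> Z" if "u \<in> Z" for u n
    by (induction n) (use assms that in auto)
  then show ?thesis
    using assms(1) by (induction n) (auto simp: linear_map_on_def)
qed

text \<open>The error made in one step is propagated by the remaining powers of \<open>A\<close>,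
  which enlarge it by a factor of at most \<open>c ^ n\<close>; there are \<open>n\<close> such
  errors.\<close>

lemma telescoping:
  fixes A :: "'v::real_normed_vector \<Rightarrow> 'v"
  assumes Z: "subspace Z" and lin: "linear_map_on Z A"
    and A: "\<And>u. u \<in> Z \<Longrightarrow> A u \<in> Z" "\<And>u. u \<in> Z \<Longrightarrow> norm (A u) \<le> c * norm u" and c: "1 \<le> c"
    and z: "\<And>k. z k \<in> Z" and e: "\<And>k. k < n \<Longrightarrow> norm (A (z k) - z (Suc k)) \<le> e"
  shows "norm ((A ^^ n) (z 0) - z n) \<le> real n * c ^ n * e"
  using e
proof (induction n)
  case 0
  then show ?case by simp
next
  case (Suc n)
  have w: "(A ^^ n) (z 0) \<in> Z" by (induction n) (use z A in auto)
  have e0: "0 \<le> e" using Suc.prems[of n] by (meson lessI norm_ge_zero order_trans)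
  have "A ((A ^^ n) (z 0)) - z (Suc n) = A ((A ^^ n) (z 0) - z n) + (A (z n) - z (Suc n))"
    using linear_map_on_diff[OF lin Z w z] by simp
  then have "norm ((A ^^ Suc n) (z 0) - z (Suc n)) \<le>
      norm (A ((A ^^ n) (z 0) - z n)) + norm (A (z n) - z (Suc n))"
    by (metis comp_apply funpow.simps(2) norm_triangle_ineq)
  also have "\<dots> \<le> c * norm ((A ^^ n) (z 0) - z n) + e"
    using w z Z Suc.prems[of n] A(2) by (intro add_mono) (auto simp: subspace_diff)
  also have "\<dots> \<le> c * (real n * c ^ n * e) + c ^ Suc n * e"
  proof (intro add_mono mult_left_mono)
    \<comment> \<open>The latest error has not been propagated yet; \<open>1 \<le> c\<close> lets it
      be charged at the same rate as the older ones.\<close>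
    show "e \<le> c ^ Suc n * e" using one_le_power[OF c, of "Suc n"] e0 by (simp add: mult_le_cancel_right1)
  qed (use Suc c in auto)
  finally show ?case by (simp add: algebra_simps)
qed

section \<open>Piecewise linear paths on a uniform grid\<close>

definition lin_interp :: "real \<Rightarrow> (nat \<Rightarrow> 'v::real_vector) \<Rightarrow> real \<Rightarrow> 'v" where
  "lin_interp h d r =
     (let i = nat \<lfloor>r / h\<rfloor>; \<theta> = r / h - real i in (1 - \<theta>) *\<^sub>R d i + \<theta> *\<^sub>R d (Suc i))"

text \<open>The cell is closed on both sides: at its right end the floor in
  \<open>lin_interp\<close> already selects the next cell, with offset 0, and both formulas give
  \<open>d (Suc i)\<close>.\<close>

lemma lin_interp_eq:
  assumes "0 < h" "real i * h \<le> r" "r \<le> real (Suc i) * h"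
  shows "lin_interp h d r = (1 - (r / h - real i)) *\<^sub>R d i + (r / h - real i) *\<^sub>R d (Suc i)"
proof (cases "r = real (Suc i) * h")
  case True
  then have "r / h = real (Suc i)" using assms(1) by simp
  then show ?thesis unfolding lin_interp_def Let_def by (simp add: nat_add_distrib)
next
  case False
  then have "real i \<le> r / h" "r / h < real i + 1"
    using assms by (auto simp: pos_le_divide_eq pos_divide_less_eq algebra_simps)
  then have "nat \<lfloor>r / h\<rfloor> = i" by linarith
  then show ?thesis unfolding lin_interp_def Let_def by simp
qed

lemma grid_cell:
  assumes "0 < h" "0 \<le> r"
  obtains i :: nat where "real i * h \<le> r" "r \<le> real (Suc i) * h"
proof
  have "real (nat \<lfloor>r / h\<rfloor>) \<le> r / h" "r / h \<le> real (Suc (nat \<lfloor>r / h\<rfloor>))"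
    using assms by (auto simp: le_nat_iff) linarith+
  then show "real (nat \<lfloor>r / h\<rfloor>) * h \<le> r" "r \<le> real (Suc (nat \<lfloor>r / h\<rfloor>)) * h"
    using assms(1) by (simp_all add: pos_le_divide_eq pos_divide_le_eq)
qed

lemma norm_convex_comb_le:
  fixes x y :: "'v::real_normed_vector"
  assumes "norm x \<le> c" "norm y \<le> c" "0 \<le> \<theta>" "\<theta> \<le> 1"
  shows "norm ((1 - \<theta>) *\<^sub>R x + \<theta> *\<^sub>R y) \<le> c"
proof -
  have "norm ((1 - \<theta>) *\<^sub>R x + \<theta> *\<^sub>R y) \<le> (1 - \<theta>) * norm x + \<theta> * norm y"
    using assms by (intro norm_triangle_le) simp
  also have "\<dots> \<le> (1 - \<theta>) * c + \<theta> * c" using assms by (intro add_mono mult_left_mono) auto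
  finally show ?thesis by (simp add: algebra_simps)
qed

text \<open>The hypothesis \<open>s \<le> h\<close> ensures that a step of the path meets at most two grid cells.\<close>

lemma lin_interp_step:
  fixes d :: "nat \<Rightarrow> 'v::real_normed_vector"
  assumes h: "0 < h" and r: "real i * h \<le> r" "r \<le> real (Suc i) * h" and s: "0 \<le> s" "s \<le> h"
    and 1: "norm (d (Suc i) - d i - h *\<^sub>R y) \<le> c * h"
    and 2: "norm (d (Suc (Suc i)) - d (Suc i) - h *\<^sub>R y) \<le> c * h"
  shows "norm (lin_interp h d (r + s) - lin_interp h d r - s *\<^sub>R y) \<le> c * s"
proof -
  \<comment> \<open>\<open>x1\<close> and \<open>x2\<close> are the defects of two consecutive
    increments against the common slope \<open>y\<close>. The defect of the step is a combination of
    them with nonnegative weights of sum \<open>s / h\<close>.\<close>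
  define x1 where "x1 = d (Suc i) - d i - h *\<^sub>R y"
  define x2 where "x2 = d (Suc (Suc i)) - d (Suc i) - h *\<^sub>R y"
  have d: "d (Suc i) = d i + x1 + h *\<^sub>R y" "d (Suc (Suc i)) = d i + x1 + x2 + h *\<^sub>R y + h *\<^sub>R y"
    unfolding x1_def x2_def by (simp_all add: algebra_simps)
  have zr: "lin_interp h d r = d i + (r / h - real i) *\<^sub>R (x1 + h *\<^sub>R y)"
    unfolding lin_interp_eq[OF h r] d by (simp add: algebra_simps)
  show ?thesis
  proof (cases "r + s \<le> real (Suc i) * h")
    case True
    have "real i * h \<le> r + s" using r s by simp
    then have "lin_interp h d (r + s) = d i + ((r + s) / h - real i) *\<^sub>R (x1 + h *\<^sub>R y)"
      unfolding lin_interp_eq[OF h \<open>real i * h \<le> r + s\<close> True] d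
      by (simp add: scaleR_add_right scaleR_diff_left)
    then have "lin_interp h d (r + s) - lin_interp h d r - s *\<^sub>R y
        = ((r + s) / h - real i - (r / h - real i)) *\<^sub>R (x1 + h *\<^sub>R y) - s *\<^sub>R y"
      unfolding zr by (simp add: scaleR_diff_left)
    also have "(r + s) / h - real i - (r / h - real i) = s / h" by (simp add: add_divide_distrib)
    also have "(s / h) *\<^sub>R (x1 + h *\<^sub>R y) - s *\<^sub>R y = (s / h) *\<^sub>R x1" using h by (simp add: scaleR_add_right)
    finally have "norm (lin_interp h d (r + s) - lin_interp h d r - s *\<^sub>R y) = (s / h) * norm x1"
      using s h by simp
    also have "\<dots> \<le> (s / h) * (c * h)" using 1 s h unfolding x1_def by (intro mult_left_mono) auto
    finally show ?thesis using h by (simp add: mult.commute)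
  next
    case False
    \<comment> \<open>In units of \<open>h\<close>, these are the parts of the step before and after
      the grid point \<open>real (Suc i) * h\<close>.\<close>
    define \<alpha> \<beta> where "\<alpha> = real (Suc i) - r / h" and "\<beta> = (r + s) / h - real (Suc i)"
    have ab: "0 \<le> \<alpha>" "0 \<le> \<beta>" "\<alpha> + \<beta> = s / h"
      using r False h by (auto simp: \<alpha>_def \<beta>_def field_simps)
    have s_eq: "s = (\<alpha> + \<beta>) * h" using ab(3) h by simp
    have "real (Suc i) * h \<le> r + s" "r + s \<le> real (Suc (Suc i)) * h"
      using False r s by (auto simp: algebra_simps)
    then have zrs: "lin_interp h d (r + s) = (1 - \<beta>) *\<^sub>R d (Suc i) + \<beta> *\<^sub>R d (Suc (Suc i))"
      using lin_interp_eq[OF h, of "Suc i" "r + s" d] unfolding \<beta>_def by blast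
    have zr': "lin_interp h d r = d i + (1 - \<alpha>) *\<^sub>R (x1 + h *\<^sub>R y)"
      unfolding zr \<alpha>_def by simp
    have sy: "s *\<^sub>R y = (\<alpha> * h) *\<^sub>R y + (\<beta> * h) *\<^sub>R y"
      unfolding s_eq by (simp add: algebra_simps)
    have "lin_interp h d (r + s) - lin_interp h d r - s *\<^sub>R y = \<alpha> *\<^sub>R x1 + \<beta> *\<^sub>R x2"
      unfolding zrs zr' sy d by (simp add: algebra_simps)
    then have "norm (lin_interp h d (r + s) - lin_interp h d r - s *\<^sub>R y)
        \<le> \<alpha> * norm x1 + \<beta> * norm x2"
      using ab by (metis abs_of_nonneg norm_scaleR norm_triangle_ineq)
    also have "\<dots> \<le> \<alpha> * (c * h) + \<beta> * (c * h)"
      using 1 2 ab unfolding x1_def x2_def by (intro add_mono mult_left_mono) auto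
    finally show ?thesis unfolding s_eq by (simp add: algebra_simps)
  qed
qed

section \<open>Convergence of the products, on the domain of the generator and then on
  \<open>Z\<close>\<close>

context contraction_semigroup
begin

text \<open>By \<open>gen_commute\<close> the pair \<open>(S t u, S t (gen S u))\<close> lies on the
  graph of the generator, which is the closure of the graph over the core.\<close>

lemma core_approx:
  assumes core: "is_core Z S D" and u: "u \<in> gen_dom Z S" and "0 \<le> t" "0 < \<epsilon>"
  obtains d where "d \<in> D" "norm (d - S t u) \<le> \<epsilon>" "norm (gen S d - S t (gen S u)) \<le> \<epsilon>"
proof -
  have "(S t u, S t (gen S u)) \<in> (\<lambda>u. (u, gen S u)) ` gen_dom Z S"
    using gen_commute[OF u \<open>0 \<le> t\<close>] by force
  then have "(S t u, S t (gen S u)) \<in> closure ((\<lambda>u. (u, gen S u)) ` D)"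
    using core unfolding is_core_def by simp
  then obtain d where d: "d \<in> D" "dist (d, gen S d) (S t u, S t (gen S u)) < \<epsilon>"
    unfolding closure_approachable using \<open>0 < \<epsilon>\<close> by blast
  show ?thesis
    using that[OF d(1)] d(2) dist_fst_le[of "(d, gen S d)" "(S t u, S t (gen S u))"]
      dist_snd_le[of "(d, gen S d)" "(S t u, S t (gen S u))"] by (simp add: dist_norm)
qed

text \<open>Working with a step \<open>s\<close> and a count \<open>n\<close> makes one
  \<open>\<delta>\<close> serve all times up to \<open>b\<close>. In the constant,
  \<open>7 * b\<close> comes from the accumulated step errors and \<open>1\<close> from replacing
  \<open>u\<close> by \<open>z 0\<close>, both enlarged by \<open>exp (w * b)\<close>; the final
  \<open>2\<close> is the distance of the path from the orbit.\<close>

lemma chernoff_on_gen_dom: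
  assumes F: "\<And>t. 0 \<le> t \<Longrightarrow> bounded_operator_on Z (F t)"
    and w: "0 \<le> w" "\<And>t u. 0 \<le> t \<Longrightarrow> u \<in> Z \<Longrightarrow> norm (F t u) \<le> exp (w * t) * norm u"
    and core: "is_core Z S D"
    and deriv: "\<And>d. d \<in> D \<Longrightarrow> ((\<lambda>t. (F t d - d) /\<^sub>R t) \<longlongrightarrow> gen S d) (at_right 0)"
    and u: "u \<in> gen_dom Z S" and b: "0 \<le> b" and \<epsilon>: "0 < \<epsilon>"
  obtains \<delta> where "0 < \<delta>" "\<And>s n. 0 < s \<Longrightarrow> s < \<delta> \<Longrightarrow> real n * s \<le> b \<Longrightarrow>
    norm ((F s ^^ n) u - S (real n * s) u) \<le> (exp (w * b) * (1 + 7 * b) + 2) * \<epsilon>"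
proof -
  define v where "v = gen S u"
  have uZ: "u \<in> Z" and vZ: "v \<in> Z" using gen_dom_Z[OF u] gen_Z[OF u] v_def by auto
  have F_closed: "F t x \<in> Z" and F_lin: "linear_map_on Z (F t)" if "0 \<le> t" "x \<in> Z" for t x
    using F[OF that(1)] that(2) unfolding bounded_operator_on_def by auto
  obtain h1 where h1: "0 < h1" "\<And>r. 0 \<le> r \<Longrightarrow> r \<le> h1 \<Longrightarrow> norm (S r u - u) \<le> \<epsilon>"
    using near_zero[OF uZ \<epsilon>] by blast
  obtain h2 where h2: "0 < h2" "\<And>r. 0 \<le> r \<Longrightarrow> r \<le> h2 \<Longrightarrow> norm (S r v - v) \<le> \<epsilon>"
    using near_zero[OF vZ \<epsilon>] by blast
  \<comment> \<open>Within a time \<open>h\<close> the orbits of \<open>u\<close> and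
    \<open>v\<close> move by at most \<open>\<epsilon>\<close>; \<open>h \<le> 1\<close> makes the
    tolerance \<open>\<epsilon> * h\<close> at most \<open>\<epsilon>\<close>.\<close>
  define h where "h = min 1 (min h1 h2)"
  have h: "0 < h" "h \<le> 1" using h1 h2 by (auto simp: h_def)
  have mu: "norm (S r u - u) \<le> \<epsilon>" and mv: "norm (S r v - v) \<le> \<epsilon>" if "0 \<le> r" "r \<le> h" for r
    using h1 h2 that by (auto simp: h_def)
  \<comment> \<open>The tolerance carries a factor \<open>h\<close> because differences of
    neighbouring nodes are compared with \<open>h\<close> times a slope.\<close>
  have "\<exists>d. d \<in> D \<and> norm (d - S (real i * h) u) \<le> \<epsilon> * h \<and>
      norm (gen S d - S (real i * h) v) \<le> \<epsilon> * h" for i :: nat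
    using core_approx[OF core u, of "real i * h" "\<epsilon> * h"] h \<epsilon> unfolding v_def
    by (metis mult_nonneg_nonneg mult_pos_pos of_nat_0_le_iff order_less_imp_le)
  then obtain d :: "nat \<Rightarrow> 'v" where d: "\<And>i. d i \<in> D"
      "\<And>i. norm (d i - S (real i * h) u) \<le> \<epsilon> * h"
      "\<And>i. norm (gen S (d i) - S (real i * h) v) \<le> \<epsilon> * h"
    by metis
  have \<epsilon>h: "\<epsilon> * h \<le> \<epsilon>" using h \<epsilon> by simp
  have dZ: "d i \<in> Z" for i
    using d(1) core gen_dom_Z unfolding is_core_def by blast
  \<comment> \<open>Every cell meeting \<open>[0, b]\<close> has both end nodes among the indices up
    to \<open>m\<close>. These are finitely many, so a single \<open>\<delta>1\<close> makes all
    their difference quotients accurate.\<close>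
  define m where "m = nat \<lceil>b / h\<rceil> + 1"
  have "\<forall>\<^sub>F s in at_right 0. \<forall>i\<in>{..m}. dist ((F s (d i) - d i) /\<^sub>R s) (gen S (d i)) < \<epsilon>"
    using tendstoD[OF deriv[OF d(1)] \<epsilon>] by (intro eventually_ball_finite) auto
  then obtain \<delta>1 where \<delta>1: "0 < \<delta>1" "\<And>s i. 0 < s \<Longrightarrow> s < \<delta>1 \<Longrightarrow> i \<le> m \<Longrightarrow>
      dist ((F s (d i) - d i) /\<^sub>R s) (gen S (d i)) < \<epsilon>"
    unfolding eventually_at_right_field by auto
  define z where "z = lin_interp h d"
  \<comment> \<open>One \<open>\<epsilon> * h\<close> is the Taylor error of the orbit, the other
    two are the distances of the two nodes from it.\<close>
  have slope: "norm (d (Suc j) - d j - h *\<^sub>R S (real j * h) v) \<le> 3 * \<epsilon> * h" for j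
  proof -
    define p where "p = real j * h"
    have p: "0 \<le> p" "real (Suc j) * h = p + h" using h by (auto simp: p_def algebra_simps)
    have memb: "S h u - u - h *\<^sub>R v \<in> Z" "S h u - u \<in> Z" "h *\<^sub>R v \<in> Z" "S h u \<in> Z"
      using uZ vZ S_closed h subspace by (auto simp: subspace_diff subspace_scale)
    have eq: "S p (S h u - u - h *\<^sub>R v) = S (p + h) u - S p u - h *\<^sub>R S p v"
      using memb p uZ vZ h by (simp add: S_diff S_scale S_semigroup)
    have "norm (S h u - u - h *\<^sub>R v) \<le> h * \<epsilon>"
      using taylor_le[OF u, of h \<epsilon>] mv h unfolding v_def by auto
    then have "norm (S (p + h) u - S p u - h *\<^sub>R S p v) \<le> \<epsilon> * h"
      using norm_S_le[OF p(1) memb(1)] unfolding eq by (simp add: mult.commute)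
    moreover have "norm (d (Suc j) - S (p + h) u) \<le> \<epsilon> * h" "norm (d j - S p u) \<le> \<epsilon> * h"
      using d(2)[of "Suc j"] d(2)[of j] unfolding p(2) p_def by auto
    moreover have "d (Suc j) - d j - h *\<^sub>R S p v = (d (Suc j) - S (p + h) u) - (d j - S p u)
        + (S (p + h) u - S p u - h *\<^sub>R S p v)"
      by simp
    ultimately show ?thesis unfolding p_def[symmetric]
      using norm_triangle_ineq[of "(d (Suc j) - S (p + h) u) - (d j - S p u)"
          "S (p + h) u - S p u - h *\<^sub>R S p v"]
        norm_triangle_ineq4[of "d (Suc j) - S (p + h) u" "d j - S p u"] by simp
  qed
  \<comment> \<open>The 7 adds up \<open>\<epsilon>\<close> for the consistency of
    \<open>F s\<close>, \<open>2 * \<epsilon>\<close> for replacing the generator at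
    \<open>z r\<close> by a reference slope, and \<open>4 * \<epsilon>\<close> for the deviation of
    the path from that slope.\<close>
  have step: "norm (F s (z r) - z (r + s)) \<le> 7 * \<epsilon> * s"
    if s: "0 < s" "s < \<delta>1" "s \<le> h" and r: "0 \<le> r" "r \<le> b" for s r
  proof -
    obtain i where i: "real i * h \<le> r" "r \<le> real (Suc i) * h" using grid_cell[OF h(1) r(1)] .
    define \<theta> where "\<theta> = r / h - real i"
    have \<theta>: "0 \<le> \<theta>" "\<theta> \<le> 1" using i h(1) by (auto simp: \<theta>_def field_simps)
    have im: "Suc i \<le> m"
    proof -
      have "real i \<le> b / h" using i(1) r(2) h(1) by (simp add: pos_le_divide_eq)
      then show ?thesis unfolding m_def by linarith
    qed
    \<comment> \<open>\<open>y\<close> is the exact slope at the left node of the cell;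
      \<open>g\<close> is the generator at \<open>z r\<close>, formed with the same weights as
      \<open>z r\<close>.\<close>
    define y where "y = S (real i * h) v"
    define g where "g = (1 - \<theta>) *\<^sub>R gen S (d i) + \<theta> *\<^sub>R gen S (d (Suc i))"
    define e where "e j = F s (d j) - d j - s *\<^sub>R gen S (d j)" for j
    have zr: "z r = (1 - \<theta>) *\<^sub>R d i + \<theta> *\<^sub>R d (Suc i)"
      unfolding z_def \<theta>_def by (rule lin_interp_eq[OF h(1) i])
    have e_le: "norm (e j) \<le> \<epsilon> * s" if "j \<le> m" for j
    proof -
      have "e j = s *\<^sub>R ((F s (d j) - d j) /\<^sub>R s - gen S (d j))"
        using s unfolding e_def by (simp add: scaleR_diff_right)
      then have "norm (e j) = s * dist ((F s (d j) - d j) /\<^sub>R s) (gen S (d j))"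
        using s by (simp add: dist_norm)
      also have "\<dots> \<le> s * \<epsilon>" using \<delta>1(2)[OF s(1,2) that] s by (intro mult_left_mono) auto
      finally show ?thesis by (simp add: mult.commute)
    qed
    have "F s (z r) = (1 - \<theta>) *\<^sub>R F s (d i) + \<theta> *\<^sub>R F s (d (Suc i))"
      unfolding zr using F_lin[of s 0] s dZ subspace
      by (simp add: linear_map_on_def subspace_scale subspace_0)
    then have "F s (z r) - z r - s *\<^sub>R g = (1 - \<theta>) *\<^sub>R e i + \<theta> *\<^sub>R e (Suc i)"
      unfolding zr g_def e_def by (simp add: algebra_simps)
    then have A: "norm (F s (z r) - z r - s *\<^sub>R g) \<le> \<epsilon> * s"
      using norm_convex_comb_le[OF e_le e_le \<theta>] im by simp
    have y_inc: "norm (S (real (Suc i) * h) v - y) \<le> \<epsilon>"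
      unfolding y_def using increment_le[OF vZ mv] h by (simp add: algebra_simps)
    have "norm (gen S (d i) - y) \<le> 2 * \<epsilon>" using d(3)[of i] \<epsilon>h \<epsilon> unfolding y_def by linarith
    moreover have "norm (gen S (d (Suc i)) - y) \<le> 2 * \<epsilon>"
      using d(3)[of "Suc i"] \<epsilon>h y_inc
        norm_triangle_ineq[of "gen S (d (Suc i)) - S (real (Suc i) * h) v" "S (real (Suc i) * h) v - y"]
      by simp
    moreover have "g - y = (1 - \<theta>) *\<^sub>R (gen S (d i) - y) + \<theta> *\<^sub>R (gen S (d (Suc i)) - y)"
      unfolding g_def by (simp add: algebra_simps)
    ultimately have "norm (g - y) \<le> 2 * \<epsilon>" using norm_convex_comb_le \<theta> by metis
    then have B: "norm (s *\<^sub>R (g - y)) \<le> 2 * \<epsilon> * s" using s by (simp add: mult.commute)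
    have "norm (z (r + s) - z r - s *\<^sub>R y) \<le> 4 * \<epsilon> * s"
      unfolding z_def
    proof (rule lin_interp_step[OF h(1) i])
      show "norm (d (Suc i) - d i - h *\<^sub>R y) \<le> 4 * \<epsilon> * h"
        using slope[of i] \<epsilon> h unfolding y_def by (smt (verit) mult_right_mono)
      \<comment> \<open>In the next cell \<open>slope\<close> refers to its own left node; moving
        the reference back to \<open>y\<close> turns the 3 into a 4.\<close>
      have "norm (h *\<^sub>R (S (real (Suc i) * h) v - y)) \<le> \<epsilon> * h"
        using y_inc h by (simp add: mult.commute)
      moreover have eq: "d (Suc (Suc i)) - d (Suc i) - h *\<^sub>R y
          = (d (Suc (Suc i)) - d (Suc i) - h *\<^sub>R S (real (Suc i) * h) v)
            + h *\<^sub>R (S (real (Suc i) * h) v - y)"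
        by (simp add: scaleR_diff_right)
      ultimately show "norm (d (Suc (Suc i)) - d (Suc i) - h *\<^sub>R y) \<le> 4 * \<epsilon> * h"
        unfolding eq
        using slope[of "Suc i"]
          norm_triangle_ineq[of "d (Suc (Suc i)) - d (Suc i) - h *\<^sub>R S (real (Suc i) * h) v"
            "h *\<^sub>R (S (real (Suc i) * h) v - y)"] by linarith
    qed (use s in auto)
    moreover have eq: "F s (z r) - z (r + s) = (F s (z r) - z r - s *\<^sub>R g) + s *\<^sub>R (g - y)
        - (z (r + s) - z r - s *\<^sub>R y)"
      by (simp add: scaleR_diff_right)
    ultimately show ?thesis
      unfolding eq
      using A B norm_triangle_ineq[of "F s (z r) - z r - s *\<^sub>R g" "s *\<^sub>R (g - y)"]
        norm_triangle_ineq4[of "(F s (z r) - z r - s *\<^sub>R g) + s *\<^sub>R (g - y)" "z (r + s) - z r - s *\<^sub>R y"]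
      by linarith
  qed
  have zZ: "z r \<in> Z" for r
    unfolding z_def lin_interp_def Let_def using dZ subspace
    by (intro subspace_add subspace_scale) auto
  \<comment> \<open>One \<open>\<epsilon>\<close> is the distance of a node from the orbit, the
    other the motion of the orbit within a cell.\<close>
  have zS: "norm (z r - S r u) \<le> 2 * \<epsilon>" if r: "0 \<le> r" for r
  proof -
    obtain i where i: "real i * h \<le> r" "r \<le> real (Suc i) * h" using grid_cell[OF h(1) r] .
    have \<theta>: "0 \<le> r / h - real i" "r / h - real i \<le> 1" using i h(1) by (auto simp: field_simps)
    have "norm (S r u - S (real i * h) u) \<le> \<epsilon>" "norm (S (real (Suc i) * h) u - S r u) \<le> \<epsilon>"
      using i h r by (auto intro!: increment_le[OF uZ mu] simp: algebra_simps)
    then have "norm (d i - S r u) \<le> 2 * \<epsilon>" "norm (d (Suc i) - S r u) \<le> 2 * \<epsilon>"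
      using d(2)[of i] d(2)[of "Suc i"] \<epsilon>h
        norm_triangle_ineq4[of "d i - S (real i * h) u" "S r u - S (real i * h) u"]
        norm_triangle_ineq[of "d (Suc i) - S (real (Suc i) * h) u" "S (real (Suc i) * h) u - S r u"]
      by auto
    moreover have "z r - S r u = (1 - (r / h - real i)) *\<^sub>R (d i - S r u)
        + (r / h - real i) *\<^sub>R (d (Suc i) - S r u)"
      unfolding z_def lin_interp_eq[OF h(1) i] by (simp add: algebra_simps)
    ultimately show ?thesis using norm_convex_comb_le[OF _ _ \<theta>] by metis
  qed
  have "z 0 = d 0" unfolding z_def lin_interp_def Let_def by simp
  then have z0: "norm (u - z 0) \<le> \<epsilon>"
    using d(2)[of 0] \<epsilon>h S_zero[OF uZ] by (simp add: norm_minus_commute)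
  show ?thesis
  proof
    \<comment> \<open>The bound by \<open>h\<close> keeps each step within two neighbouring
      cells.\<close>
    show "0 < min \<delta>1 h" using \<delta>1(1) h(1) by simp
    fix s n assume s: "0 < s" "s < min \<delta>1 h" and n: "real n * s \<le> b"
    define c where "c = exp (w * s)"
    have c: "1 \<le> c" using w(1) s by (simp add: c_def)
    have c_n: "c ^ n \<le> exp (w * b)"
    proof -
      have "c ^ n = exp (w * (real n * s))" by (simp add: c_def exp_of_nat_mult[symmetric] mult_ac)
      then show ?thesis using n w(1) by (simp add: mult_left_mono)
    qed
    have le: "real k * s \<le> b" if "k < n" for k
      using n that s by (smt (verit) mult_right_mono of_nat_le_iff less_imp_le)
    have "norm ((F s ^^ n) (z (real 0 * s)) - z (real n * s)) \<le> real n * c ^ n * (7 * \<epsilon> * s)"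
    proof (rule telescoping[OF subspace, where z = "\<lambda>k. z (real k * s)"])
      show "linear_map_on Z (F s)" using F_lin[OF _ uZ] s by simp
      show "norm (F s (z (real k * s)) - z (real (Suc k) * s)) \<le> 7 * \<epsilon> * s" if "k < n" for k
        using step[of s "real k * s"] le[OF that] s by (simp add: algebra_simps)
    qed (use F_closed w(2) s c zZ in \<open>auto simp: c_def\<close>)
    also have "\<dots> = c ^ n * (real n * s) * (7 * \<epsilon>)" by simp
    also have "\<dots> \<le> exp (w * b) * b * (7 * \<epsilon>)"
      using c_n n c s \<epsilon> b by (intro mult_right_mono mult_mono) auto
    finally have 1: "norm ((F s ^^ n) (z 0) - z (real n * s)) \<le> exp (w * b) * b * (7 * \<epsilon>)" by simp
    \<comment> \<open>The products start at \<open>u\<close> but the path starts at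
      \<open>z 0\<close>; stability controls how this initial gap grows.\<close>
    have "norm ((F s ^^ n) (u - z 0)) \<le> c ^ n * norm (u - z 0)"
      by (rule funpow_bound[where Z=Z, THEN conjunct2])
         (use F_closed w(2) s c zZ uZ subspace in \<open>auto simp: c_def subspace_diff\<close>)
    also have "\<dots> \<le> exp (w * b) * \<epsilon>" using c_n z0 by (intro mult_mono) auto
    also have "(F s ^^ n) (u - z 0) = (F s ^^ n) u - (F s ^^ n) (z 0)"
      using linear_map_on_diff[OF linear_map_on_funpow[OF F_lin[OF _ uZ] F_closed subspace] subspace uZ zZ] s
      by simp
    finally have 2: "norm ((F s ^^ n) u - (F s ^^ n) (z 0)) \<le> exp (w * b) * \<epsilon>" .
    have 3: "norm (z (real n * s) - S (real n * s) u) \<le> 2 * \<epsilon>" using zS s by simp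
    have "norm ((F s ^^ n) u - S (real n * s) u) \<le>
        exp (w * b) * \<epsilon> + exp (w * b) * b * (7 * \<epsilon>) + 2 * \<epsilon>"
      using norm_triangle_mono[OF norm_triangle_mono[OF 2 1] 3] by simp
    then show "norm ((F s ^^ n) u - S (real n * s) u) \<le> (exp (w * b) * (1 + 7 * b) + 2) * \<epsilon>"
      by (simp add: algebra_simps)
  qed
qed

text \<open>The products and the semigroup are bounded uniformly for times up to \<open>b\<close>,
  so convergence on the dense core extends to all of \<open>Z\<close>.\<close>

theorem chernoff:
  assumes "chernoff_equivalent Z F S" and f: "f \<in> Z" and b: "0 \<le> b"
  shows "uniform_limit {0..b} (\<lambda>n t. (F (t / real n) ^^ n) f) (\<lambda>t. S t f) sequentially"
proof -
  obtain w0 D where F: "\<And>t. 0 \<le> t \<Longrightarrow> bounded_operator_on Z (F t)" and F0: "\<And>u. u \<in> Z \<Longrightarrow> F 0 u = u"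
    and w0: "\<And>t. 0 \<le> t \<Longrightarrow> onorm_on Z (F t) \<le> exp (w0 * t)"
    and core: "is_core Z S D"
    and deriv: "\<And>d. d \<in> D \<Longrightarrow> ((\<lambda>t. (F t d - d) /\<^sub>R t) \<longlongrightarrow> gen S d) (at_right 0)"
    using assms(1) unfolding chernoff_equivalent_def by blast
  \<comment> \<open>A nonnegative rate makes the one-step bound \<open>exp (w * s)\<close> at least
    1, as \<open>telescoping\<close> requires, and its powers at most
    \<open>exp (w * b)\<close>.\<close>
  define w where "w = \<bar>w0\<bar>"
  have w: "0 \<le> w" unfolding w_def by simp
  have Fw: "norm (F t u) \<le> exp (w * t) * norm u" if "0 \<le> t" "u \<in> Z" for t u
  proof (rule onorm_on_bound[OF F[OF that(1)] _ that(2)])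
    show "onorm_on Z (F t) \<le> exp (w * t)"
      using w0[OF that(1)] that(1) unfolding w_def
      by (smt (verit, best) abs_ge_self exp_le_cancel_iff mult_right_mono)
  qed
  have F_closed: "F t x \<in> Z" and F_lin: "linear_map_on Z (F t)" if "0 \<le> t" "x \<in> Z" for t x
    using F[OF that(1)] that(2) unfolding bounded_operator_on_def by auto
  define C where "C = exp (w * b) * (1 + 7 * b) + 2"
  \<comment> \<open>The summands account for the products applied to \<open>f - u\<close>, for the
    contraction \<open>S t\<close> applied to \<open>u - f\<close>, and for the convergence at
    \<open>u\<close>.\<close>
  define C' where "C' = exp (w * b) + 1 + C"
  have C: "0 < C" "0 < C'" using b by (auto simp: C_def C'_def intro!: add_pos_pos add_nonneg_pos mult_nonneg_nonneg)
  show ?thesis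
  proof (rule uniform_limitI)
    fix e :: real assume e: "0 < e"
    \<comment> \<open>The factor 2 makes the final bound strict.\<close>
    define \<epsilon> where "\<epsilon> = e / (2 * C')"
    have \<epsilon>: "0 < \<epsilon>" using e C by (simp add: \<epsilon>_def)
    have "f \<in> closure D" using core f unfolding is_core_def by blast
    then obtain u where u: "u \<in> D" "dist u f < \<epsilon>" unfolding closure_approachable using \<epsilon> by blast
    have ud: "u \<in> gen_dom Z S" and uZ: "u \<in> Z"
      using u core gen_dom_Z unfolding is_core_def by auto
    obtain \<delta> where \<delta>: "0 < \<delta>" "\<And>s n. 0 < s \<Longrightarrow> s < \<delta> \<Longrightarrow> real n * s \<le> b \<Longrightarrow>
        norm ((F s ^^ n) u - S (real n * s) u) \<le> C * \<epsilon>"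
      using chernoff_on_gen_dom[OF F w Fw core deriv ud b \<epsilon>] unfolding C_def by blast
    \<comment> \<open>The lower bound on \<open>n\<close> puts every step \<open>t / n\<close> with
      \<open>t \<le> b\<close> below \<open>\<delta>\<close>. The time 0 is treated apart because
      the convergence estimate concerns positive steps.\<close>
    have le: "dist ((F (t / real n) ^^ n) f) (S t f) < e"
      if n: "0 < n" "b / \<delta> < real n" and t: "t \<in> {0..b}" for n t
    proof (cases "t = 0")
      case True
      have "(F 0 ^^ n) f = f" by (induction n) (use F0 f in auto)
      then show ?thesis using True S_zero f e by simp
    next
      case False
      define s where "s = t / real n"
      have s: "0 < s" "s < \<delta>" "real n * s = t"
      proof -
        show "0 < s" "real n * s = t" using False t n by (auto simp: s_def)
        have "t < \<delta> * real n" using n t \<delta>(1) by (simp add: pos_divide_less_eq mult.commute)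
        then show "s < \<delta>" using n by (simp add: s_def pos_divide_less_eq)
      qed
      have cn: "exp (w * s) ^ n \<le> exp (w * b)"
      proof -
        have "exp (w * s) ^ n = exp (w * (real n * s))" by (simp add: exp_of_nat_mult[symmetric] mult_ac)
        then show ?thesis using t w s(3) by (simp add: mult_left_mono)
      qed
      have "norm ((F s ^^ n) (f - u)) \<le> exp (w * s) ^ n * norm (f - u)"
        by (rule funpow_bound[where Z=Z, THEN conjunct2])
           (use F_closed Fw s f uZ subspace in \<open>auto simp: subspace_diff\<close>)
      also have "\<dots> \<le> exp (w * b) * \<epsilon>"
        using cn u(2) by (intro mult_mono) (auto simp: dist_norm norm_minus_commute)
      also have "(F s ^^ n) (f - u) = (F s ^^ n) f - (F s ^^ n) u"
        using linear_map_on_diff[OF linear_map_on_funpow[OF F_lin[OF _ uZ] F_closed subspace] subspace f uZ] s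
        by simp
      finally have 1: "norm ((F s ^^ n) f - (F s ^^ n) u) \<le> exp (w * b) * \<epsilon>" .
      have 2: "norm ((F s ^^ n) u - S t u) \<le> C * \<epsilon>" using \<delta>(2)[OF s(1,2), of n] s(3) t by simp
      have 3: "norm (S t u - S t f) \<le> \<epsilon>"
        using norm_S_diff_le[of t u f] t uZ f u(2) by (simp add: dist_norm)
      have "norm ((F s ^^ n) f - S t f) \<le> exp (w * b) * \<epsilon> + C * \<epsilon> + \<epsilon>"
        using norm_triangle_mono[OF norm_triangle_mono[OF 1 2] 3] by simp
      also have "\<dots> = C' * \<epsilon>" by (simp add: C'_def algebra_simps)
      also have "\<dots> < e" using C e by (simp add: \<epsilon>_def)
      finally show ?thesis by (simp add: dist_norm s_def)
    qed
    have "\<forall>\<^sub>F n in sequentially. 0 < n \<and> b / \<delta> < real n"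
      using eventually_gt_at_top[of 0] eventually_gt_at_top[of "nat \<lceil>b / \<delta>\<rceil>"]
      by eventually_elim linarith
    then show "\<forall>\<^sub>F n in sequentially. \<forall>t\<in>{0..b}. dist ((F (t / real n) ^^ n) f) (S t f) < e"
      by eventually_elim (use le in blast)
  qed
qed

end

section \<open>Functions vanishing outside a bounded open set\<close>

lemma Cc_subset_C0: "Cc \<subseteq> (C0 :: ('a::euclidean_space \<Rightarrow>\<^sub>C real) set)"
proof
  fix f :: "'a \<Rightarrow>\<^sub>C real" assume "f \<in> Cc"
  then have "bounded {x. f x \<noteq> 0}"
    unfolding Cc_def by (auto intro: bounded_subset[OF compact_imp_bounded closure_subset])
  then obtain B where B: "\<And>x. f x \<noteq> 0 \<Longrightarrow> norm x \<le> B" unfolding bounded_iff by blast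
  have "\<forall>\<^sub>F x in at_infinity. f x = 0"
    unfolding eventually_at_infinity by (rule exI[of _ "B + 1"]) (use B in force)
  then show "f \<in> C0"
    unfolding C0_def using tendsto_cong[of "apply_bcontfun f" "\<lambda>_. 0" at_infinity 0] by simp
qed

lemma subspace_C0_on: "subspace (C0_on G)"
  unfolding subspace_def C0_on_def
  by (simp add: plus_bcontfun.rep_eq scaleR_bcontfun.rep_eq zero_bcontfun.rep_eq)

text \<open>The sub-Markov property for \<open>f / norm f\<close> and for its negative bounds
  \<open>T t f\<close> from both sides.\<close>

lemma feller_contraction:
  assumes T: "feller_semigroup Z T" and Z: "subspace Z" and t: "0 \<le> t" and f: "f \<in> Z"
  shows "norm (T t f) \<le> norm f"
proof (cases "f = 0")
  case True
  have "bounded_operator_on Z (T t)" using T t unfolding feller_semigroup_def sc_semigroup_def by simp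
  then obtain K where "\<And>u. u \<in> Z \<Longrightarrow> norm (T t u) \<le> K * norm u"
    unfolding bounded_operator_on_def by auto
  from this[OF f] True show ?thesis by simp
next
  case False
  have "bounded_operator_on Z (T t)" using T t unfolding feller_semigroup_def sc_semigroup_def by simp
  then have scale: "T t (c *\<^sub>R f) = c *\<^sub>R T t f" for c
    using f unfolding bounded_operator_on_def linear_map_on_def by simp
  have le: "c * T t f x \<le> 1" if "\<bar>c\<bar> = 1 / norm f" for c x
  proof -
    have "c * f x \<le> 1" for x
    proof -
      have "c * f x \<le> \<bar>c\<bar> * \<bar>f x\<bar>" by (metis abs_ge_self abs_mult)
      also have "\<dots> \<le> \<bar>c\<bar> * norm f" using norm_bounded[of f x] by (intro mult_left_mono) auto
      also have "\<dots> = 1" using that False by simp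
      finally show ?thesis .
    qed
    then have "\<forall>x. apply_bcontfun (c *\<^sub>R f) x \<le> 1" by (simp add: scaleR_bcontfun.rep_eq)
    then have "T t (c *\<^sub>R f) x \<le> 1"
      using T t subspace_scale[OF Z f, of c] unfolding feller_semigroup_def by simp
    then show ?thesis unfolding scale by (simp add: scaleR_bcontfun.rep_eq)
  qed
  show ?thesis
  proof (rule norm_bound)
    show "norm (T t f x) \<le> norm f" for x
    proof -
      have "\<bar>T t f x\<bar> / norm f \<le> 1"
        using le[of "1 / norm f" x] le[of "- (1 / norm f)" x] by (auto simp: abs_if)
      then show ?thesis using False by (simp add: pos_divide_le_eq)
    qed
  qed
qed

text \<open>The ball about \<open>x\<close> reaching to the nearest frontier point misses the
  frontier; being connected and meeting \<open>G\<close>, it lies in \<open>G\<close>. Boundedness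
  of \<open>G\<close> ensures that there is a frontier, openness that \<open>y\<close> lies
  outside.\<close>

lemma frontier_point:
  fixes G :: "'a::euclidean_space set"
  assumes G: "open G" "bounded G" and x: "x \<in> G"
  obtains y where "y \<in> frontier G" "y \<notin> G" "infdist x (frontier G) = dist x y" "0 < dist x y"
    "ball x (dist x y) \<subseteq> G"
proof -
  have "G \<noteq> UNIV" using G(2) not_bounded_UNIV by auto
  then have ne: "frontier G \<noteq> {}" using x frontier_eq_empty by blast
  obtain y where y: "y \<in> frontier G" "infdist x (frontier G) = dist x y"
    using infdist_attains_inf[OF frontier_closed ne, of x] by blast
  have yG: "y \<notin> G" using y(1) G(1) by (simp add: frontier_def interior_open)
  then have pos: "0 < dist x y" using x by auto
  have "ball x (dist x y) \<inter> frontier G = {}"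
    using infdist_le[of _ "frontier G" x] y(2) by (fastforce simp: disjoint_iff)
  moreover have "x \<in> ball x (dist x y) \<inter> G" using x pos by simp
  ultimately have "ball x (dist x y) - G = {}"
    using connected_Int_frontier[OF connected_ball, of x "dist x y" G] by fast
  then have "ball x (dist x y) \<subseteq> G" by simp
  then show ?thesis by (rule that[OF y(1) yG y(2) pos])
qed

text \<open>Uniform continuity on the compact closure compares \<open>x\<close> with its nearest
  frontier point, where \<open>g\<close> vanishes.\<close>

lemma C0_on_small_near_frontier:
  fixes G :: "'a::euclidean_space set"
  assumes G: "open G" "bounded G" and g: "g \<in> C0_on G" and e: "0 < e"
  obtains \<delta> where "0 < \<delta>" "\<And>x. x \<in> G \<Longrightarrow> infdist x (frontier G) < \<delta> \<Longrightarrow> \<bar>apply_bcontfun g x\<bar> < e"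
proof -
  have "uniformly_continuous_on (closure G) (apply_bcontfun g)"
    using G(2) by (intro compact_uniformly_continuous) (auto intro!: continuous_intros simp: compact_closure)
  then obtain \<delta> where \<delta>: "0 < \<delta>" "\<And>x y. x \<in> closure G \<Longrightarrow> y \<in> closure G \<Longrightarrow> dist y x < \<delta> \<Longrightarrow>
      dist (g y) (g x) < e"
    unfolding uniformly_continuous_on_def using e by meson
  show ?thesis
  proof (rule that[OF \<delta>(1)])
    fix x assume x: "x \<in> G" "infdist x (frontier G) < \<delta>"
    obtain y where y: "y \<in> frontier G" "y \<notin> G" "infdist x (frontier G) = dist x y"
      by (rule frontier_point[OF G x(1)])
    have "g y = 0" using g y(2) by (simp add: C0_on_def)
    moreover have "y \<in> closure G" "x \<in> closure G"
      using y(1) x(1) closure_subset by (auto simp: frontier_def)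
    ultimately show "\<bar>g x\<bar> < e" using \<delta>(2)[of y x] x(2) y(3) by (simp add: dist_norm)
  qed
qed

text \<open>This is the mean value inequality between \<open>x\<close> and its nearest frontier
  point, where \<open>f\<close> vanishes. As \<open>G\<close> may fail to be convex, it is used on
  the ball about \<open>x\<close> that reaches to that point.\<close>

lemma C2b_le_infdist_frontier:
  fixes G :: "'a::euclidean_space set"
  assumes G: "open G" "bounded G" and f: "f \<in> C0_on G" "C2b_on G (apply_bcontfun f)"
  obtains C where "0 \<le> C" "\<And>x. x \<in> G \<Longrightarrow> \<bar>apply_bcontfun f x\<bar> \<le> C * infdist x (frontier G)"
proof -
  define D where "D x = frechet_derivative (apply_bcontfun f) (at x)" for x
  have D: "(apply_bcontfun f has_derivative D x) (at x)" if "x \<in> G" for x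
  proof -
    have "partials [] (apply_bcontfun f) differentiable at x"
      using f(2) that unfolding C2b_on_def Ck_on_def by (auto dest!: bspec[of _ _ "[]"])
    then show ?thesis unfolding D_def by (simp add: frechet_derivative_works)
  qed
  have "bounded ((\<lambda>x. D x i) ` G)" if "i \<in> Basis" for i
  proof -
    have "[i] \<in> lists Basis" "length [i] \<le> 2" using that by auto
    then have "bounded (partials [i] (apply_bcontfun f) ` G)"
      using f(2) unfolding C2b_on_def by blast
    then show ?thesis by (simp add: D_def)
  qed
  then have "\<forall>i\<in>Basis. \<exists>B. \<forall>x\<in>G. \<bar>D x i\<bar> \<le> B" unfolding bounded_iff by simp
  then obtain B where B: "\<And>i x. i \<in> Basis \<Longrightarrow> x \<in> G \<Longrightarrow> \<bar>D x i\<bar> \<le> B i" by metis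
  \<comment> \<open>Each coordinate of a vector is at most its norm, so the bounds on the partial
    derivatives add up to a bound on the derivative.\<close>
  define C where "C = (\<Sum>i\<in>Basis. \<bar>B i\<bar>)"
  have onorm: "onorm (D x) \<le> C" if "x \<in> G" for x
  proof (rule onorm_le)
    fix h
    have lin: "linear (D x)" using D[OF that] by (rule has_derivative_linear)
    have "D x h = (\<Sum>i\<in>Basis. (h \<bullet> i) * D x i)"
      using Linear_Algebra.linear_componentwise[OF lin, of h 1] by simp
    also have "norm \<dots> \<le> (\<Sum>i\<in>Basis. norm h * \<bar>B i\<bar>)"
    proof (rule sum_norm_le)
      fix i :: 'a assume i: "i \<in> Basis"
      show "norm ((h \<bullet> i) * D x i) \<le> norm h * \<bar>B i\<bar>"
        unfolding norm_mult using B[OF i that] Basis_le_norm[OF i, of h]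
        by (intro mult_mono) auto
    qed
    finally show "norm (D x h) \<le> C * norm h" by (simp add: C_def sum_distrib_left mult.commute)
  qed
  show ?thesis
  proof
    show C: "0 \<le> C" unfolding C_def by (simp add: sum_nonneg)
    fix x assume x: "x \<in> G"
    obtain y where y: "y \<notin> G" "infdist x (frontier G) = dist x y" "0 < dist x y"
      "ball x (dist x y) \<subseteq> G"
      by (rule frontier_point[OF G x])
    define r where "r = dist x y"
    \<comment> \<open>\<open>f\<close> may fail to be differentiable at \<open>y\<close>, so the
      bound is shown on the open ball and passes to \<open>y\<close> by continuity.\<close>
    have "ball x r \<subseteq> {z. norm (f z - f x) \<le> C * r}"
    proof
      fix z assume z: "z \<in> ball x r"
      have "norm (f z - f x) \<le> C * norm (z - x)"
      proof (rule differentiable_bound[OF convex_ball[of x r]])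
        show "(apply_bcontfun f has_derivative D p) (at p within ball x r)" if "p \<in> ball x r" for p
          by (rule has_derivative_at_withinI[OF D]) (use y(4) that r_def in blast)
        show "onorm (D p) \<le> C" if "p \<in> ball x r" for p
          by (rule onorm) (use y(4) that r_def in blast)
      qed (use z y(3) in \<open>auto simp: r_def\<close>)
      also have "\<dots> \<le> C * r"
        using z C by (intro mult_left_mono) (auto simp: dist_norm norm_minus_commute)
      finally show "z \<in> {z. norm (f z - f x) \<le> C * r}" by simp
    qed
    moreover have "closed {z. norm (f z - f x) \<le> C * r}"
      by (intro closed_Collect_le continuous_intros) auto
    ultimately have "closure (ball x r) \<subseteq> {z. norm (f z - f x) \<le> C * r}" by (rule closure_minimal)
    moreover have "y \<in> closure (ball x r)" using y(3) by (simp add: r_def)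
    moreover have "f y = 0" using f(1) y(1) by (simp add: C0_on_def)
    ultimately show "\<bar>f x\<bar> \<le> C * infdist x (frontier G)" unfolding y(2) r_def by auto
  qed
qed

section \<open>The killed family\<close>

text \<open>\<open>E\<close> preserves norms, and multiplication by \<open>\<phi> t\<close> does not
  increase them and cuts functions off outside \<open>G\<close>. Hence the growth rate of
  \<open>F\<close> carries over.\<close>

lemma bounded_operator_on_killed_family:
  assumes F: "\<And>t. 0 \<le> t \<Longrightarrow> bounded_operator_on C0 (F t)"
    and E: "\<And>f. f \<in> C0_on G \<Longrightarrow> E f \<in> C0" "linear_map_on (C0_on G) E"
      "\<And>f. f \<in> C0_on G \<Longrightarrow> norm (E f) = norm f"
    and \<phi>: "\<And>x. \<bar>apply_bcontfun (\<phi> t) x\<bar> \<le> 1" "\<phi> t \<in> C0_on G"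
    and t: "0 < t"
  shows "bounded_operator_on (C0_on G) (killed_family \<phi> F E t)"
    and "f \<in> C0_on G \<Longrightarrow> norm (killed_family \<phi> F E t f) \<le> onorm_on C0 (F t) * norm f"
proof -
  have eq: "killed_family \<phi> F E t f = bcontfun_mult (\<phi> t) (F t (E f))" for f
    using t by (simp add: killed_family_def)
  have Ft: "bounded_operator_on C0 (F t)" using F t by simp
  show le: "norm (killed_family \<phi> F E t f) \<le> onorm_on C0 (F t) * norm f" if "f \<in> C0_on G" for f
  proof (rule norm_bound)
    fix x
    have "norm (killed_family \<phi> F E t f x) \<le> 1 * norm (F t (E f) x)"
      unfolding eq apply_bcontfun_mult norm_mult using \<phi>(1) by (intro mult_right_mono) auto
    also have "\<dots> \<le> norm (F t (E f))" using norm_bounded[of "F t (E f)" x] by simp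
    also have "\<dots> \<le> onorm_on C0 (F t) * norm f"
      using onorm_on_bound[OF Ft order_refl E(1)[OF that]] E(3)[OF that] by simp
    finally show "norm (killed_family \<phi> F E t f x) \<le> onorm_on C0 (F t) * norm f" .
  qed
  show "bounded_operator_on (C0_on G) (killed_family \<phi> F E t)"
    unfolding bounded_operator_on_def
  proof (intro conjI ballI)
    show "killed_family \<phi> F E t u \<in> C0_on G" for u
      using \<phi>(2) unfolding C0_on_def eq by simp
    show "\<exists>K. \<forall>u\<in>C0_on G. norm (killed_family \<phi> F E t u) \<le> K * norm u" using le by blast
    have lin: "linear_map_on C0 (F t)" using Ft unfolding bounded_operator_on_def by blast
    show "linear_map_on (C0_on G) (killed_family \<phi> F E t)"
      using lin E(1,2) unfolding linear_map_on_def eq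
      by (auto intro!: bcontfun_eqI simp: plus_bcontfun.rep_eq scaleR_bcontfun.rep_eq algebra_simps)
  qed
qed

lemma onorm_on_le:
  assumes "Z \<noteq> {}" "0 \<le> c" "\<And>u. u \<in> Z \<Longrightarrow> norm (A u) \<le> c * norm u"
  shows "onorm_on Z A \<le> c"
  unfolding onorm_on_def
proof (rule cSUP_least[OF assms(1)])
  show "norm (A u) / norm u \<le> c" if "u \<in> Z" for u
    using assms(2,3) that by (cases "u = 0") (auto simp: pos_divide_le_eq)
qed

text \<open>\<open>g'\<close> and \<open>g\<close> play the generators at \<open>E f\<close> and at
  \<open>f\<close>. They are identified on \<open>G\<close> only, and \<open>g \<in> C0_on G\<close>
  provides the smallness near the frontier.\<close>

lemma killed_family_deriv:
  fixes G :: "'a::euclidean_space set" and g g' :: "'a \<Rightarrow>\<^sub>C real"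
  assumes G: "open G" "bounded G"
    and f: "f \<in> C0_on G" "C2b_on G (apply_bcontfun f)"
    and Ef: "\<And>x. x \<in> G \<Longrightarrow> apply_bcontfun (E f) x = apply_bcontfun f x"
    and g: "((\<lambda>t. (F t (E f) - E f) /\<^sub>R t) \<longlongrightarrow> g') (at_right 0)"
      "g \<in> C0_on G" "\<And>x. x \<in> G \<Longrightarrow> apply_bcontfun g' x = apply_bcontfun g x"
    and s: "((\<lambda>t. s t / t) \<longlongrightarrow> 0) (at_right 0)"
    and \<phi>: "\<And>t x. t > 0 \<Longrightarrow> apply_bcontfun (\<phi> t) x \<in> {0..1}"
      "\<And>t. t > 0 \<Longrightarrow> \<phi> t \<in> C0_on G"
      "\<And>t x. t > 0 \<Longrightarrow> x \<in> G \<Longrightarrow> infdist x (frontier G) > s t \<Longrightarrow> apply_bcontfun (\<phi> t) x = 1"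
  shows "((\<lambda>t. (killed_family \<phi> F E t f - f) /\<^sub>R t) \<longlongrightarrow> g) (at_right 0)"
proof (rule tendstoI)
  fix e :: real assume "0 < e"
  \<comment> \<open>Three errors of size \<open>\<epsilon>\<close> occur below, which leaves room
    for a strict inequality.\<close>
  define \<epsilon> where "\<epsilon> = e / 4"
  have \<epsilon>: "0 < \<epsilon>" using \<open>0 < e\<close> by (simp add: \<epsilon>_def)
  obtain C where C: "0 \<le> C" "\<And>x. x \<in> G \<Longrightarrow> \<bar>f x\<bar> \<le> C * infdist x (frontier G)"
    using C2b_le_infdist_frontier[OF G f] by blast
  obtain \<delta> where \<delta>: "0 < \<delta>" "\<And>x. x \<in> G \<Longrightarrow> infdist x (frontier G) < \<delta> \<Longrightarrow> \<bar>g x\<bar> < \<epsilon>"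
    using C0_on_small_near_frontier[OF G g(2) \<epsilon>] by blast
  \<comment> \<open>The width \<open>s t\<close> itself tends to 0, so the strip where
    \<open>\<phi> t\<close> may differ from 1 is eventually thinner than
    \<open>\<delta>\<close>.\<close>
  have "((\<lambda>t. s t / t * t) \<longlongrightarrow> 0 * 0) (at_right 0)" by (intro tendsto_mult s tendsto_ident_at)
  then have "\<forall>\<^sub>F t in at_right 0. s t / t * t < \<delta>"
    using \<delta>(1) by (intro order_tendstoD(2)) auto
  moreover have "((\<lambda>t. C * (s t / t)) \<longlongrightarrow> C * 0) (at_right 0)" by (intro tendsto_mult s tendsto_const)
  then have "\<forall>\<^sub>F t in at_right 0. C * (s t / t) < \<epsilon>"
    using \<epsilon> by (intro order_tendstoD(2)) auto
  moreover have "\<forall>\<^sub>F t in at_right 0. dist ((F t (E f) - E f) /\<^sub>R t) g' < \<epsilon>"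
    using g(1) \<epsilon> by (rule tendstoD)
  moreover have "\<forall>\<^sub>F t in at_right (0::real). 0 < t" by (rule eventually_at_right_less)
  ultimately show "\<forall>\<^sub>F t in at_right 0. dist ((killed_family \<phi> F E t f - f) /\<^sub>R t) g < e"
  proof eventually_elim
    case (elim t)
    note t = \<open>0 < t\<close>
    let ?q = "(F t (E f) - E f) /\<^sub>R t - g'"
    let ?d = "(killed_family \<phi> F E t f - f) /\<^sub>R t - g"
    have "norm (?d x) \<le> 3 * \<epsilon>" for x
    proof (cases "x \<in> G")
      case False
      then show ?thesis using t f(1) g(2) \<phi>(2)[OF t] \<epsilon>
        by (simp add: killed_family_def C0_on_def minus_bcontfun.rep_eq scaleR_bcontfun.rep_eq)
    next
      case True
      \<comment> \<open>As \<open>E f = f\<close> and \<open>g' = g\<close> on \<open>G\<close>,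
        everything except the error of \<open>F\<close> collects the factor
        \<open>\<phi> t x - 1\<close>, which vanishes off the strip.\<close>
      have "?d x = \<phi> t x * ?q x + (\<phi> t x - 1) * (g x + f x / t)"
        using t Ef[OF True] g(3)[OF True]
        by (simp add: killed_family_def minus_bcontfun.rep_eq scaleR_bcontfun.rep_eq field_simps)
      then have "norm (?d x) \<le> \<bar>\<phi> t x * ?q x\<bar> + \<bar>(\<phi> t x - 1) * (g x + f x / t)\<bar>"
        by (metis abs_triangle_ineq real_norm_def)
      moreover have "\<bar>\<phi> t x * ?q x\<bar> \<le> \<epsilon>"
      proof -
        have "\<bar>\<phi> t x * ?q x\<bar> \<le> 1 * \<bar>?q x\<bar>"
          unfolding abs_mult using \<phi>(1)[OF t, of x] by (intro mult_right_mono) auto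
        also have "\<dots> \<le> norm ?q" using norm_bounded[of ?q x] by simp
        also have "\<dots> \<le> \<epsilon>" using elim by (simp add: dist_norm)
        finally show ?thesis .
      qed
      moreover have "\<bar>(\<phi> t x - 1) * (g x + f x / t)\<bar> \<le> 2 * \<epsilon>"
      proof (cases "infdist x (frontier G) > s t")
        case True
        then show ?thesis using \<phi>(3)[OF t \<open>x \<in> G\<close>] \<epsilon> by simp
      next
        case False
        then have "\<bar>g x\<bar> < \<epsilon>" using \<delta>(2)[OF True] elim t by simp
        moreover have "\<bar>f x / t\<bar> \<le> \<epsilon>"
        proof -
          have "\<bar>f x\<bar> \<le> C * s t"
            using C(2)[OF True] mult_left_mono[OF _ C(1), of "infdist x (frontier G)" "s t"] False by simp
          then have "\<bar>f x / t\<bar> \<le> C * (s t / t)" using t by (simp add: divide_right_mono abs_divide)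
          then show ?thesis using elim by linarith
        qed
        ultimately have "\<bar>g x + f x / t\<bar> \<le> 2 * \<epsilon>" by linarith
        moreover have "\<bar>\<phi> t x - 1\<bar> \<le> 1" using \<phi>(1)[OF t, of x] by auto
        ultimately have "\<bar>\<phi> t x - 1\<bar> * \<bar>g x + f x / t\<bar> \<le> 1 * (2 * \<epsilon>)"
          by (intro mult_mono) auto
        then show ?thesis by (simp add: abs_mult)
      qed
      ultimately show ?thesis by linarith
    qed
    then have "norm ?d \<le> 3 * \<epsilon>" by (rule norm_bound)
    then show ?case using \<epsilon> by (simp add: dist_norm \<epsilon>_def)
  qed
qed

section \<open>Chernoff equivalence for the killed semigroup\<close>

theorem theorem3p1:
  fixes M :: "'w measure"
    and P :: "'a::euclidean_space \<Rightarrow> 'w measure"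
    and \<xi> :: "real \<Rightarrow> 'w \<Rightarrow> 'a option"
    and T F To :: "real \<Rightarrow> ('a \<Rightarrow>\<^sub>C real) \<Rightarrow> ('a \<Rightarrow>\<^sub>C real)"
    and D D\<^sub>o :: "('a \<Rightarrow>\<^sub>C real) set"
    and G :: "'a set"
    and E :: "('a \<Rightarrow>\<^sub>C real) \<Rightarrow> ('a \<Rightarrow>\<^sub>C real)"
    and s :: "real \<Rightarrow> real"
    and \<phi> :: "real \<Rightarrow> 'a \<Rightarrow>\<^sub>C real"
  assumes process: "doubly_feller_process M P \<xi> T"
    and F: "chernoff_equivalent C0 F T"
    and D: "is_core C0 T D"
      "\<And>f. f \<in> D \<Longrightarrow> ((\<lambda>t. norm ((F t f - f) /\<^sub>R t - gen T f)) \<longlongrightarrow> 0) (at_right 0)"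
    and G: "open G" "connected G" "bounded G" "regular_set P \<xi> G"
    and To: "killed_feller_semigroup P \<xi> G To"
    and D\<^sub>o: "D\<^sub>o \<subseteq> gen_dom (C0_on G) To \<inter> {f. C2b_on G (apply_bcontfun f)}"
    and E: "\<And>f. f \<in> C0_on G \<Longrightarrow> E f \<in> Cc"
    and i: "is_core (C0_on G) To D\<^sub>o"
    and ii: "\<And>f x. f \<in> C0_on G \<Longrightarrow> x \<in> closure G \<Longrightarrow> apply_bcontfun (E f) x = apply_bcontfun f x"
    and iii: "linear_map_on (C0_on G) E"
    and iv: "\<And>f. f \<in> C0_on G \<Longrightarrow> norm f = norm (E f)"
    and v: "E ` D\<^sub>o \<subseteq> D"
    and vi: "\<And>f x. f \<in> D\<^sub>o \<Longrightarrow> x \<in> G \<Longrightarrow>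
      apply_bcontfun (gen T (E f)) x = apply_bcontfun (gen To f) x"
    and s: "\<And>t. t > 0 \<Longrightarrow> s t > 0" "continuous_on {0<..} s"
      "mono_on {0<..} s \<or> antimono_on {0<..} s" "((\<lambda>t. s t / t) \<longlongrightarrow> 0) (at_right 0)"
    and \<phi>: "\<And>t x. t > 0 \<Longrightarrow> apply_bcontfun (\<phi> t) x \<in> {0..1}"
      "\<And>t. t > 0 \<Longrightarrow> test_function_on G (apply_bcontfun (\<phi> t))"
      "\<And>t x. t > 0 \<Longrightarrow> x \<in> G \<Longrightarrow> infdist x (frontier G) > s t \<Longrightarrow> apply_bcontfun (\<phi> t) x = 1"
      "\<And>t'. t' > 0 \<Longrightarrow> ((\<lambda>t. norm (\<phi> t - \<phi> t')) \<longlongrightarrow> 0) (at t')"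
  shows "chernoff_equivalent (C0_on G) (killed_family \<phi> F E) To \<and>
    (\<forall>f\<in>C0_on G. \<forall>b\<ge>0.
      uniform_limit {0..b} (\<lambda>n t. (killed_family \<phi> F E (t / real n) ^^ n) f) (\<lambda>t. To t f)
        sequentially)"
proof -
  let ?Z = "C0_on G" and ?K = "killed_family \<phi> F E"
  have feller: "feller_semigroup ?Z To" using To unfolding killed_feller_semigroup_def by blast
  interpret contraction_semigroup ?Z To
    using feller subspace_C0_on feller_contraction[OF feller subspace_C0_on]
    by unfold_locales (auto simp: feller_semigroup_def)
  \<comment> \<open>Boundedness and growth are taken from the equivalence for \<open>F\<close>; the
    derivative at 0 comes later from the hypothesis on \<open>D\<close>.\<close>
  obtain w where F': "\<And>t. 0 \<le> t \<Longrightarrow> bounded_operator_on C0 (F t)"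
    and w: "\<And>t. 0 \<le> t \<Longrightarrow> onorm_on C0 (F t) \<le> exp (w * t)"
    using F unfolding chernoff_equivalent_def by blast
  have EC0: "E f \<in> C0" if "f \<in> ?Z" for f
    using E[OF that] Cc_subset_C0 by (rule subsetD[rotated])
  have \<phi>Z: "\<phi> t \<in> ?Z" if "0 < t" for t
  proof -
    have "{x. apply_bcontfun (\<phi> t) x \<noteq> 0} \<subseteq> G"
      using \<phi>(2)[OF that] order_trans[OF closure_subset] unfolding test_function_on_def by metis
    then show ?thesis unfolding C0_on_def by blast
  qed
  have \<phi>1: "\<bar>apply_bcontfun (\<phi> t) x\<bar> \<le> 1" if "0 < t" for t x using \<phi>(1)[OF that, of x] by auto
  have bounded: "bounded_operator_on ?Z (?K t)"
    and le: "\<And>f. f \<in> ?Z \<Longrightarrow> norm (?K t f) \<le> onorm_on C0 (F t) * norm f" if "0 < t" for t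
    using bounded_operator_on_killed_family[where F = F and E = E and G = G and \<phi> = \<phi> and t = t, 
        OF F' EC0 iii iv[symmetric] \<phi>1[OF that] \<phi>Z[OF that] that]
    by blast+
  have id: "bounded_operator_on ?Z (?K 0)"
    unfolding bounded_operator_on_def linear_map_on_def killed_family_def
    by (auto intro!: exI[of _ 1])
  have ne: "?Z \<noteq> {}" using subspace_C0_on subspace_0 by blast
  have K: "chernoff_equivalent ?Z ?K To"
    unfolding chernoff_equivalent_def
  \<comment> \<open>The witnesses are the growth rate \<open>w\<close> of \<open>F\<close> and the
    core \<open>D\<^sub>o\<close>, whose elements have the bounded derivatives that
    \<open>killed_family_deriv\<close> uses.\<close>
  proof (intro conjI exI ballI allI impI)
    show "sc_semigroup ?Z To" by (rule semigroup)
    show "bounded_operator_on ?Z (?K t)" if "0 \<le> t" for t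
      using that id bounded[of t] by (cases "t = 0") auto
    show "?K 0 u = u" for u by (simp add: killed_family_def)
    show "onorm_on ?Z (?K t) \<le> exp (w * t)" if "0 \<le> t" for t
    proof (rule onorm_on_le[OF ne])
      fix u assume u: "u \<in> ?Z"
      show "norm (?K t u) \<le> exp (w * t) * norm u"
      proof (cases "t = 0")
        case True
        then show ?thesis by (simp add: killed_family_def)
      next
        case False
        then have "norm (?K t u) \<le> onorm_on C0 (F t) * norm u" using le[OF _ u] that by simp
        also have "\<dots> \<le> exp (w * t) * norm u" using w[OF that] by (rule mult_right_mono) simp
        finally show ?thesis .
      qed
    qed simp
    show "is_core ?Z To D\<^sub>o" by (rule i)
    fix f assume f: "f \<in> D\<^sub>o"
    have fd: "f \<in> gen_dom ?Z To" and fC: "C2b_on G (apply_bcontfun f)" using f D\<^sub>o by auto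
    show "((\<lambda>t. (?K t f - f) /\<^sub>R t) \<longlongrightarrow> gen To f) (at_right 0)"
    proof (rule killed_family_deriv[OF G(1,3) gen_dom_Z[OF fd] fC])
      show "apply_bcontfun (E f) x = apply_bcontfun f x" if "x \<in> G" for x
        using ii[OF gen_dom_Z[OF fd]] subsetD[OF closure_subset that] .
      have "E f \<in> D" using v f by blast
      then show "((\<lambda>t. (F t (E f) - E f) /\<^sub>R t) \<longlongrightarrow> gen T (E f)) (at_right 0)"
        by (intro LIM_zero_cancel[OF tendsto_norm_zero_cancel[OF D(2)]])
    qed (use gen_Z[OF fd] vi[OF f] s(4) \<phi>(1,3) \<phi>Z in auto)
  qed
  with chernoff[OF K] show ?thesis by blast
qed

end
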